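(* The operator $\mathcal{S}^t\colon (F,\psi)\mapsto \mathcal{S}^t_\psi F$, where $\mathcal{S}^t_\psi$ is the shearlet synthesis operator with respect to $\psi$, is a continuous bilinear mapping from $\mathcal{S}(\mathbb{S})\times\mathcal{S}_0(\mathbb{R}^2)$ into $\mathcal{S}_0(\mathbb{R}^2)$. In particular, the shearlet synthesis operator $\mathcal{S}^t_\psi$ is a continuous operator from $\mathcal{S}(\mathbb{S})$ into $\mathcal{S}_0(\mathbb{R}^2)$ for every $\psi\in\mathcal{S}_0(\mathbb{R}^2)$.
   Context: Notation: $\mathbb{N}=\{0,1,2,\dots\}$, $\mathbb{R}^\times=\mathbb{R}\setminus\{0\}$, $\langle x\rangle=(1+|x|^2)^{1/2}$. Shearlet group: $\mathbb{S}=\mathbb{R}^2\times\mathbb{R}\times\mathbb{R}^\times$; put $N_s=\begin{bmatrix}1&-s\\0&1\end{bmatrix}$ and $A_a=a\begin{bmatrix}1&0\\0&|a|^{-1/2}\end{bmatrix}$. For a function $\psi$ on $\mathbb{R}^2$ and $(b,s,a)\in\mathbb{S}$, $\pi_{b,s,a}\psi(x)=|a|^{-3/4}\psi(A_a^{-1}N_s^{-1}(x-b))$. Lizorkin space: $\mathcal{S}_0(\mathbb{R}^2)=\{\varphi\in\mathcal{S}(\mathbb{R}^2):\int_{\mathbb{R}^2}x^m\varphi(x)\,dx=0\ \text{for all } m\in\mathbb{N}^2\}$, where $\mathcal{S}(\mathbb{R}^2)$ is the Schwartz space with the topology given by the norms $\rho_\nu(\varphi)=\sup_{x\in\mathbb{R}^2,\,|m|\le\nu}\langle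 x\rangle^\nu|\partial^m\varphi(x)|$, $\nu\in\mathbb{N}$; $\mathcal{S}_0(\mathbb{R}^2)$ carries the relative topology. The space $\mathcal{S}(\mathbb{S})$ consists of all $\Phi\in C^\infty(\mathbb{S})$ such that for all $k_1,k_2,l,m,\alpha_1,\alpha_2,\beta,\gamma\in\mathbb{N}$ the norm $$\rho^{\alpha_1,\alpha_2,\beta,\gamma}_{k_1,k_2,l,m}(\Phi)=\sup_{((b_1,b_2),s,a)\in\mathbb{S}}\langle b_1\rangle^{k_1}\langle b_2\rangle^{k_2}\langle s\rangle^l\Big(|a|^m+\frac1{|a|^m}\Big)\big|\partial_a^\gamma\partial_s^\beta\partial_{b_2}^{\alpha_2}\partial_{b_1}^{\alpha_1}\Phi((b_1,b_2),s,a)\big|$$ is finite; its topology is defined by these norms. Shearlet synthesis operator: for $\psi\in L^1(\mathbb{R}^2)$ and $F\in\mathcal{S}(\mathbb{S})$, $$\mathcal{S}^t_\psi F(x)=\int_{\mathbb{R}^\times}\int_{\mathbb{R}}\int_{\mathbb{R}^2}F(b,s,a)\,\pi_{b,s,a}\psi(x)\,\frac{db\,ds\,da}{|a|^3},\qquad x\in\mathbb{R}^2.$$ *)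

theory Defs
  imports "HOL-Analysis.Analysis"
begin

section \<open>Smooth functions and partial derivatives\<close>

primrec Ck_on :: "nat \<Rightarrow> 'a::real_normed_vector set \<Rightarrow> ('a \<Rightarrow> complex) \<Rightarrow> bool" where
  "Ck_on 0 U f \<longleftrightarrow> continuous_on U f"
| "Ck_on (Suc k) U f \<longleftrightarrow>
     (\<forall>x\<in>U. f differentiable at x) \<and>
     (\<forall>v. Ck_on k U (\<lambda>x. frechet_derivative f (at x) v))"

text \<open>Only meant for open sets \<open>U\<close>.\<close>

definition smooth_on :: "'a::real_normed_vector set \<Rightarrow> ('a \<Rightarrow> complex) \<Rightarrow> bool" where
  "smooth_on U f \<longleftrightarrow> (\<forall>k. Ck_on k U f)"

definition dir_deriv :: "'a::real_normed_vector \<Rightarrow> ('a \<Rightarrow> complex) \<Rightarrow> 'a \<Rightarrow> complex" where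
  "dir_deriv v f x = vector_derivative (\<lambda>t::real. f (x + t *\<^sub>R v)) (at 0)"

definition jbracket :: "'a::real_normed_vector \<Rightarrow> real" where
  "jbracket x = sqrt (1 + (norm x)\<^sup>2)"


section \<open>Linear maps and topologies on spaces of complex functions\<close>

definition linear_on_space ::
  "('a \<Rightarrow> complex) set \<Rightarrow> (('a \<Rightarrow> complex) \<Rightarrow> ('b \<Rightarrow> complex)) \<Rightarrow> bool" where
  "linear_on_space V T \<longleftrightarrow>
     (\<forall>f\<in>V. \<forall>g\<in>V. \<forall>c d. T (\<lambda>x. c * f x + d * g x) = (\<lambda>y. c * T f y + d * T g y))"

definition bilinear_on_spaces ::
  "('a \<Rightarrow> complex) set \<Rightarrow> ('b \<Rightarrow> complex) set \<Rightarrow>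
   (('a \<Rightarrow> complex) \<Rightarrow> ('b \<Rightarrow> complex) \<Rightarrow> ('c \<Rightarrow> complex)) \<Rightarrow> bool" where
  "bilinear_on_spaces V W B \<longleftrightarrow>
     (\<forall>f\<in>V. linear_on_space W (B f)) \<and> (\<forall>g\<in>W. linear_on_space V (\<lambda>f. B f g))"

text \<open>
  The locally convex topology on \<open>V\<close> defined by the seminorms in \<open>P\<close>: the semi-balls form a
  subbase. Seminorms take values in \<^typ>\<open>ennreal\<close>, so that suprema over unbounded sets
  are \<open>\<infinity>\<close>; they are finite on the spaces below.
\<close>

definition seminorm_topology ::
  "('a \<Rightarrow> complex) set \<Rightarrow> (('a \<Rightarrow> complex) \<Rightarrow> ennreal) set \<Rightarrow> ('a \<Rightarrow> complex) topology" where
  "seminorm_topology V P =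
     topology_generated_by
       {{g \<in> V. p (\<lambda>x. g x - f x) < ennreal e} | p f e. p \<in> P \<and> f \<in> V \<and> 0 < e}"


section \<open>Schwartz and Lizorkin spaces on the plane\<close>

definition partial_deriv :: "nat ^ 2 \<Rightarrow> (real ^ 2 \<Rightarrow> complex) \<Rightarrow> real ^ 2 \<Rightarrow> complex" where
  "partial_deriv m f =
     (dir_deriv (axis 1 1) ^^ (m $ 1)) ((dir_deriv (axis 2 1) ^^ (m $ 2)) f)"

definition schwartz_norm :: "nat \<Rightarrow> (real ^ 2 \<Rightarrow> complex) \<Rightarrow> ennreal" where
  "schwartz_norm \<nu> f =
     (SUP (x, m) \<in> UNIV \<times> {m. (\<Sum>i\<in>UNIV. m $ i) \<le> \<nu>}.
        ennreal (jbracket x ^ \<nu> * norm (partial_deriv m f x)))"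

definition schwartz_space :: "(real ^ 2 \<Rightarrow> complex) set" where
  "schwartz_space = {f. smooth_on UNIV f \<and> (\<forall>\<nu>. schwartz_norm \<nu> f < \<infinity>)}"

definition schwartz_topology :: "(real ^ 2 \<Rightarrow> complex) topology" where
  "schwartz_topology = seminorm_topology schwartz_space (range schwartz_norm)"

definition lizorkin_space :: "(real ^ 2 \<Rightarrow> complex) set" where
  "lizorkin_space =
     {f \<in> schwartz_space.
        \<forall>m :: nat ^ 2. (LINT x|lborel. complex_of_real (\<Prod>i\<in>UNIV. (x $ i) ^ (m $ i)) * f x) = 0}"

definition lizorkin_topology :: "(real ^ 2 \<Rightarrow> complex) topology" where
  "lizorkin_topology = subtopology schwartz_topology lizorkin_space"


section \<open>The shearlet group and its space of test functions\<close>

definition shearlet_group :: "((real ^ 2) \<times> real \<times> real) set" where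
  "shearlet_group = {(b, s, a). a \<noteq> 0}"

definition shearlet_deriv ::
  "nat \<Rightarrow> nat \<Rightarrow> nat \<Rightarrow> nat \<Rightarrow>
   ((real ^ 2) \<times> real \<times> real \<Rightarrow> complex) \<Rightarrow> (real ^ 2) \<times> real \<times> real \<Rightarrow> complex" where
  "shearlet_deriv \<alpha>1 \<alpha>2 \<beta> \<gamma> \<Phi> =
     (dir_deriv (0, 0, 1) ^^ \<gamma>)
       ((dir_deriv (0, 1, 0) ^^ \<beta>)
         ((dir_deriv (axis 2 1, 0, 0) ^^ \<alpha>2)
           ((dir_deriv (axis 1 1, 0, 0) ^^ \<alpha>1) \<Phi>)))"

definition shearlet_norm ::
  "nat \<Rightarrow> nat \<Rightarrow> nat \<Rightarrow> nat \<Rightarrow> nat \<Rightarrow> nat \<Rightarrow> nat \<Rightarrow> nat \<Rightarrow>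
   ((real ^ 2) \<times> real \<times> real \<Rightarrow> complex) \<Rightarrow> ennreal" where
  "shearlet_norm k1 k2 l m \<alpha>1 \<alpha>2 \<beta> \<gamma> \<Phi> =
     (SUP (b, s, a) \<in> shearlet_group.
        ennreal (jbracket (b $ 1) ^ k1 * jbracket (b $ 2) ^ k2 * jbracket s ^ l *
          (\<bar>a\<bar> ^ m + 1 / \<bar>a\<bar> ^ m) * norm (shearlet_deriv \<alpha>1 \<alpha>2 \<beta> \<gamma> \<Phi> (b, s, a))))"

text \<open>
  A function on the group is represented by its extension by \<open>0\<close> to \<open>a = 0\<close>, so that elements
  of the space below correspond bijectively to functions on the group. The group is open in the
  ambient type, so smoothness and derivatives on it do not depend on the extension.
\<close>

definition shearlet_space :: "((real ^ 2) \<times> real \<times> real \<Rightarrow> complex) set" where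
  "shearlet_space =
     {\<Phi>. (\<forall>p. p \<notin> shearlet_group \<longrightarrow> \<Phi> p = 0) \<and> smooth_on shearlet_group \<Phi> \<and>
         (\<forall>k1 k2 l m \<alpha>1 \<alpha>2 \<beta> \<gamma>. shearlet_norm k1 k2 l m \<alpha>1 \<alpha>2 \<beta> \<gamma> \<Phi> < \<infinity>)}"

definition shearlet_topology :: "((real ^ 2) \<times> real \<times> real \<Rightarrow> complex) topology" where
  "shearlet_topology =
     seminorm_topology shearlet_space
       {shearlet_norm k1 k2 l m \<alpha>1 \<alpha>2 \<beta> \<gamma> | k1 k2 l m \<alpha>1 \<alpha>2 \<beta> \<gamma>. True}"


section \<open>Shearlet synthesis\<close>

definition shear_matrix :: "real \<Rightarrow> real ^ 2 ^ 2" where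
  "shear_matrix s = vector [vector [1, - s], vector [0, 1]]"

definition dilation_matrix :: "real \<Rightarrow> real ^ 2 ^ 2" where
  "dilation_matrix a = a *\<^sub>R vector [vector [1, 0], vector [0, \<bar>a\<bar> powr (- 1 / 2)]]"

definition shearlet_rep ::
  "real ^ 2 \<Rightarrow> real \<Rightarrow> real \<Rightarrow> (real ^ 2 \<Rightarrow> complex) \<Rightarrow> real ^ 2 \<Rightarrow> complex" where
  "shearlet_rep b s a \<psi> x =
     complex_of_real (\<bar>a\<bar> powr (- 3 / 4)) *
       \<psi> (matrix_inv (dilation_matrix a) *v (matrix_inv (shear_matrix s) *v (x - b)))"

definition synthesis_integrand ::
  "(real ^ 2 \<Rightarrow> complex) \<Rightarrow> ((real ^ 2) \<times> real \<times> real \<Rightarrow> complex) \<Rightarrow> real ^ 2 \<Rightarrow>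
   (real ^ 2) \<times> real \<times> real \<Rightarrow> complex" where
  "synthesis_integrand \<psi> F x =
     (\<lambda>(b, s, a). F (b, s, a) * shearlet_rep b s a \<psi> x / complex_of_real (\<bar>a\<bar> ^ 3))"

definition shearlet_synthesis ::
  "(real ^ 2 \<Rightarrow> complex) \<Rightarrow> ((real ^ 2) \<times> real \<times> real \<Rightarrow> complex) \<Rightarrow> real ^ 2 \<Rightarrow> complex" where
  "shearlet_synthesis \<psi> F x =
     (LINT a:- {0}|lborel. (LINT s|lborel. (LINT b|lborel. synthesis_integrand \<psi> F x (b, s, a))))"


section \<open>Underlying sets of the topologies\<close>

lemma funpow_dir_deriv_zero: "(dir_deriv v ^^ n) (\<lambda>x. 0) = (\<lambda>x. 0)"
  by (induction n) (auto simp: dir_deriv_def)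

lemma topspace_seminorm_topology:
  assumes "P \<noteq> {}" and "\<And>p. p \<in> P \<Longrightarrow> p (\<lambda>x. 0) = 0"
  shows "topspace (seminorm_topology V P) = V"
proof -
  obtain p where p: "p \<in> P" using assms(1) by blast
  have "f \<in> \<Union> {{g \<in> V. p (\<lambda>x. g x - f x) < ennreal e} | p f e. p \<in> P \<and> f \<in> V \<and> 0 < e}"
    if f: "f \<in> V" for f
  proof
    show "f \<in> {g \<in> V. p (\<lambda>x. g x - f x) < ennreal 1}" using f assms(2)[OF p] by simp
    show "{g \<in> V. p (\<lambda>x. g x - f x) < ennreal 1}
        \<in> {{g \<in> V. p (\<lambda>x. g x - f x) < ennreal e} | p f e. p \<in> P \<and> f \<in> V \<and> 0 < e}"
      using p f zero_less_one by blast
  qed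
  then show ?thesis
    unfolding seminorm_topology_def topology_generated_by_topspace by blast
qed

lemma topspace_schwartz_topology: "topspace schwartz_topology = schwartz_space"
  unfolding schwartz_topology_def
  by (rule topspace_seminorm_topology)
    (auto simp: schwartz_norm_def partial_deriv_def funpow_dir_deriv_zero
      intro!: antisym SUP_least)

lemma topspace_lizorkin_topology: "topspace lizorkin_topology = lizorkin_space"
  unfolding lizorkin_topology_def topspace_subtopology topspace_schwartz_topology
  by (auto simp: lizorkin_space_def)

lemma topspace_shearlet_topology: "topspace shearlet_topology = shearlet_space"
  unfolding shearlet_topology_def
proof (rule topspace_seminorm_topology)
  show "{shearlet_norm k1 k2 l m \<alpha>1 \<alpha>2 \<beta> \<gamma> | k1 k2 l m \<alpha>1 \<alpha>2 \<beta> \<gamma>. True} \<noteq> {}"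
    by blast
qed (auto simp: shearlet_norm_def shearlet_deriv_def funpow_dir_deriv_zero
      intro!: antisym SUP_least)

end

theory Submission imports Defs
begin

text \<open>
  Up to the factor \<open>|a| powr (- 3 / 4) / |a| ^ 3\<close>, the synthesis operator is a superposition
  \<open>\<integral> W(b, s, a) \<phi>(M(x - b))\<close> over the group, where \<open>M = A\<^sub>a\<inverse> N\<^sub>s\<inverse>\<close> and \<open>W\<close> decays faster than every power
  of the weight \<open>q = \<langle>b\<rangle> \<langle>s\<rangle> (|a| + 1 / |a|)\<close>. Since \<open>M\<close> and its inverse grow at most linearly in \<open>q\<close>, one
  has \<open>\<langle>x\<rangle> \<le> 16 q\<^sup>2 \<langle>M(x - b)\<rangle>\<close>, which transfers decay in \<open>x\<close> to decay of \<open>\<phi>\<close>. Differentiating in \<open>x\<close>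
  keeps the form of the superposition: \<open>\<phi>\<close> is replaced by its partial derivatives and \<open>W\<close> is multiplied by entries of
  \<open>M\<close>. So a single norm of \<open>F\<close>, without derivatives, controls everything. The moments vanish by Fubini's
  theorem, since an affine substitution turns monomials into polynomials.
\<close>

subsection \<open>Directional derivatives of smooth functions\<close>

text \<open>The obstacle is that the factors in \<open>a\<close> are singular at
  \<open>a = 0\<close> and that \<open>M\<close> is unbounded, so no estimate of \<open>M\<close> is
  uniform over the group: decay of \<open>W\<close> has to pay for everything. The class
  \<open>rapid\<close> keeps only measurability, vanishing off the group and decay of every order in
  \<open>q\<close>. It is therefore closed under factors of polynomial growth in \<open>q\<close>,
  and induction on the order of differentiation can run inside it. The orders add up as follows. For
  the Schwartz norm of order \<open>\<nu>\<close>, moving the weight from \<open>x\<close> to the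
  argument of \<phi> costs \<open>2 * \<nu>\<close> powers of \<open>q\<close>, the at most \<nu>
  derivatives cost one power each, integrability on the four-dimensional group costs 6, and
  \<open>|a| powr (- 3 / 4) / |a| ^ 3\<close> costs 4; hence the order \<open>3 * \<nu> + 10\<close>
  for \<open>F\<close>. For \<psi>, weight \<nu> and at most \<nu> further derivatives of a
  derivative-free norm are governed by the single index of \<open>schwartz_norm\<close>; hence
  \<open>2 * \<nu>\<close>. Joint continuity rests on one estimate that is linear in each of these
  two norms.\<close>

lemma dir_deriv_eq_has_derivative:
  fixes f :: "'a::real_normed_vector \<Rightarrow> complex"
  assumes "(f has_derivative f') (at x)"
  shows "dir_deriv v f x = f' v"
proof -
  interpret bounded_linear f' using assms by (rule has_derivative_bounded_linear)
  have "((\<lambda>t::real. x + t *\<^sub>R v) has_derivative (\<lambda>t. t *\<^sub>R v)) (at 0)"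
    by (auto intro!: derivative_eq_intros)
  moreover have "(f has_derivative f') (at (x + 0 *\<^sub>R v))" using assms by simp
  ultimately have "((\<lambda>t::real. f (x + t *\<^sub>R v)) has_derivative (\<lambda>t. f' (t *\<^sub>R v))) (at 0)"
    by (rule has_derivative_compose)
  then have "((\<lambda>t::real. f (x + t *\<^sub>R v)) has_vector_derivative f' v) (at 0)"
    by (simp add: has_vector_derivative_def scaleR)
  then show ?thesis unfolding dir_deriv_def by (rule vector_derivative_at)
qed

lemma dir_deriv_eq_frechet:
  fixes f :: "'a::real_normed_vector \<Rightarrow> complex"
  shows "f differentiable at x \<Longrightarrow> dir_deriv v f x = frechet_derivative f (at x) v"
  by (rule dir_deriv_eq_has_derivative) (simp add: frechet_derivative_works)

text \<open>Smoothness is defined by Frechet derivatives, the Schwartz norms by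
  \<open>dir_deriv\<close>. In this form inductions on the order can be carried out with
  \<open>dir_deriv\<close> alone.\<close>

lemma Ck_Suc_UNIV:
  "Ck_on (Suc k) UNIV f \<longleftrightarrow>
     (\<forall>x. f differentiable at x) \<and> (\<forall>v. Ck_on k UNIV (dir_deriv v f))"
proof (cases "\<forall>x. f differentiable at x")
  case True
  then have "dir_deriv v f = (\<lambda>x. frechet_derivative f (at x) v)" for v
    by (auto simp: dir_deriv_eq_frechet)
  then show ?thesis by simp
qed auto

lemma smooth_differentiable: "smooth_on UNIV f \<Longrightarrow> f differentiable at x"
  unfolding smooth_on_def by (metis Ck_Suc_UNIV)

lemma smooth_dir_deriv: "smooth_on UNIV f \<Longrightarrow> smooth_on UNIV (dir_deriv v f)"
  unfolding smooth_on_def by (metis Ck_Suc_UNIV)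

lemma smooth_dir_deriv_funpow:
  "smooth_on UNIV f \<Longrightarrow> smooth_on UNIV ((dir_deriv v ^^ n) f)"
  by (induction n) (auto intro: smooth_dir_deriv)

lemma smooth_continuous:
  fixes f :: "'a::real_normed_vector \<Rightarrow> complex"
  shows "smooth_on UNIV f \<Longrightarrow> continuous_on UNIV f"
  unfolding smooth_on_def by (metis Ck_on.simps(1))

lemma smooth_has_derivative:
  fixes f :: "'a::real_normed_vector \<Rightarrow> complex"
  assumes "smooth_on UNIV f"
  shows "(f has_derivative (\<lambda>v. dir_deriv v f x)) (at x)"
proof -
  note d = smooth_differentiable[OF assms, of x]
  have "(\<lambda>v. dir_deriv v f x) = frechet_derivative f (at x)"
    using dir_deriv_eq_frechet[OF d] by auto
  then show ?thesis using d by (simp add: frechet_derivative_works)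
qed

section \<open>Linearity of iterated directional derivatives\<close>

lemma dir_deriv_lincomb:
  assumes "f differentiable at x" "g differentiable at x"
  shows "dir_deriv v (\<lambda>x. c * f x + d * g x) x = c * dir_deriv v f x + d * dir_deriv v g x"
proof -
  have "((\<lambda>x. c * f x + d * g x) has_derivative
     (\<lambda>v. c * frechet_derivative f (at x) v + d * frechet_derivative g (at x) v)) (at x)"
    using assms by (auto simp: frechet_derivative_works intro!: derivative_eq_intros)
  then show ?thesis
    by (simp add: dir_deriv_eq_has_derivative assms dir_deriv_eq_frechet)
qed

lemma Ck_lincomb:
  assumes "Ck_on k UNIV f" "Ck_on k UNIV g"
  shows "Ck_on k UNIV (\<lambda>x. c * f x + d * g x)"
  using assms
proof (induction k arbitrary: f g)
  case 0
  then show ?case by (auto intro!: continuous_intros)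
next
  case (Suc k)
  then have df: "\<And>x. f differentiable at x" "\<And>x. g differentiable at x"
    and ck: "\<And>v. Ck_on k UNIV (dir_deriv v f)" "\<And>v. Ck_on k UNIV (dir_deriv v g)"
    unfolding Ck_Suc_UNIV by auto
  have "dir_deriv v (\<lambda>x. c * f x + d * g x) = (\<lambda>x. c * dir_deriv v f x + d * dir_deriv v g x)" for v
    using dir_deriv_lincomb df by blast
  moreover have "(\<lambda>x. c * f x + d * g x) differentiable at x" for x
    using df by (auto intro!: derivative_intros)
  ultimately show ?case unfolding Ck_Suc_UNIV using Suc.IH[OF ck] by simp
qed

lemma smooth_lincomb:
  "smooth_on UNIV f \<Longrightarrow> smooth_on UNIV g \<Longrightarrow> smooth_on UNIV (\<lambda>x. c * f x + d * g x)"
  unfolding smooth_on_def by (auto intro: Ck_lincomb)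

lemma dir_deriv_funpow_lincomb:
  assumes "smooth_on UNIV f" "smooth_on UNIV g"
  shows "(dir_deriv v ^^ n) (\<lambda>x. c * f x + d * g x) =
    (\<lambda>x. c * (dir_deriv v ^^ n) f x + d * (dir_deriv v ^^ n) g x)"
proof (induction n)
  case (Suc n)
  show ?case
    by (simp add: Suc fun_eq_iff dir_deriv_lincomb
      smooth_differentiable smooth_dir_deriv_funpow assms)
qed simp

lemma partial_deriv_lincomb:
  assumes "smooth_on UNIV f" "smooth_on UNIV g"
  shows "partial_deriv m (\<lambda>x. c * f x + d * g x) =
    (\<lambda>x. c * partial_deriv m f x + d * partial_deriv m g x)"
  by (simp add: partial_deriv_def dir_deriv_funpow_lincomb smooth_dir_deriv_funpow assms)

section \<open>Mean value estimates along lines and symmetry of second derivatives\<close>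

lemma norm_diff_le_vector_derivative:
  fixes f :: "real \<Rightarrow> complex"
  assumes t: "0 \<le> t"
    and f: "\<And>s. 0 \<le> s \<Longrightarrow> s \<le> t \<Longrightarrow> (f has_vector_derivative f' s) (at s)"
    and b: "\<And>s. 0 \<le> s \<Longrightarrow> s \<le> t \<Longrightarrow> norm (f' s) \<le> B"
  shows "norm (f t - f 0) \<le> B * t"
proof -
  have "norm (f t - f 0) \<le> B * norm (t - 0)"
  proof (rule differentiable_bound[where S = "{0..t}"])
    fix s assume s: "s \<in> {0..t}"
    show "(f has_derivative (\<lambda>h. h *\<^sub>R f' s)) (at s within {0..t})"
      using f[of s] s by (auto simp: has_vector_derivative_def intro: has_derivative_at_withinI)
    show "onorm (\<lambda>h. h *\<^sub>R f' s) \<le> B"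
      by (rule onorm_le) (use b[of s] s in \<open>simp_all add: mult.commute[of B] mult_left_mono\<close>)
  qed (use t in auto)
  then show ?thesis using t by simp
qed

lemma smooth_has_vector_derivative_line:
  fixes f :: "'a::real_normed_vector \<Rightarrow> complex"
  assumes "smooth_on UNIV f"
  shows "((\<lambda>t. f (x + t *\<^sub>R v)) has_vector_derivative dir_deriv v f (x + t *\<^sub>R v)) (at t)"
proof -
  have "((\<lambda>t::real. x + t *\<^sub>R v) has_derivative (\<lambda>t. t *\<^sub>R v)) (at t)"
    by (auto intro!: derivative_eq_intros)
  from has_derivative_compose[OF this smooth_has_derivative[OF assms]]
  have 1: "((\<lambda>t. f (x + t *\<^sub>R v)) has_derivative (\<lambda>s. dir_deriv (s *\<^sub>R v) f (x + t *\<^sub>R v))) (at t)" .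
  interpret bounded_linear "\<lambda>w. dir_deriv w f (x + t *\<^sub>R v)"
    using smooth_has_derivative[OF assms] by (rule has_derivative_bounded_linear)
  show ?thesis using 1 by (simp add: has_vector_derivative_def scaleR)
qed

text \<open>The second difference quotient is symmetric in the two directions and approximates both
  iterated derivatives.\<close>

lemma second_difference_approx:
  fixes f :: "'a::real_normed_vector \<Rightarrow> complex"
  assumes f: "smooth_on UNIV f" and e: "0 < e"
  shows "\<exists>d>0. \<forall>t. 0 < t \<and> t < d \<longrightarrow>
    norm (f (x + t *\<^sub>R u + t *\<^sub>R v) - f (x + t *\<^sub>R u) - f (x + t *\<^sub>R v) + f x
      - of_real (t * t) * dir_deriv v (dir_deriv u f) x) \<le> e * (t * t)"
proof -
  define c where "c = dir_deriv v (dir_deriv u f) x"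
  have su: "smooth_on UNIV (dir_deriv u f)" by (rule smooth_dir_deriv[OF f])
  have "continuous_on UNIV (dir_deriv v (dir_deriv u f))"
    by (intro smooth_continuous smooth_dir_deriv f)
  then obtain r where r: "r > 0" "\<And>z. dist z x < r \<Longrightarrow> dist (dir_deriv v (dir_deriv u f) z) c < e"
    using e unfolding continuous_on_iff c_def by (metis UNIV_I)
  \<comment> \<open>With this radius the whole parallelogram spanned by \<open>t *\<^sub>R u\<close>
    and \<open>t *\<^sub>R v\<close> stays where the mixed derivative is within \<open>e\<close> of
    \<open>c\<close>; the summand 1 keeps the denominator positive.\<close>
  define d where "d = r / (norm u + norm v + 1)"
  have d: "d > 0" using r by (simp add: d_def add_nonneg_pos)
  have main: "norm (f (x + t *\<^sub>R u + t *\<^sub>R v) - f (x + t *\<^sub>R u) - f (x + t *\<^sub>R v) + f x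
      - of_real (t * t) * c) \<le> e * (t * t)" if t: "0 < t" "t < d" for t
  proof -
    have near: "dist (x + a *\<^sub>R u + b *\<^sub>R v) x < r" if "0 \<le> a" "a \<le> t" "0 \<le> b" "b \<le> t" for a b
    proof -
      have "dist (x + a *\<^sub>R u + b *\<^sub>R v) x \<le> a * norm u + b * norm v"
        using that norm_triangle_ineq[of "a *\<^sub>R u" "b *\<^sub>R v"] by (simp add: dist_norm add.assoc)
      also have "\<dots> \<le> t * (norm u + norm v)"
        using that by (simp add: distrib_left add_mono mult_right_mono)
      also have "\<dots> \<le> t * (norm u + norm v + 1)" using t by simp
      also have "\<dots> < d * (norm u + norm v + 1)"
        using t by (intro mult_strict_right_mono) (auto simp: add_nonneg_pos)
      also have "\<dots> = r"
        using add_nonneg_pos[of "norm u + norm v" 1] by (simp add: d_def)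
      finally show ?thesis .
    qed
    \<comment> \<open>Mean value inequality in direction \<open>v\<close> for the
      \<open>u\<close>-derivative minus its expected growth \<open>s *\<^sub>R c\<close>. The result
      bounds the derivative of \<open>?h\<close> below, to which the inequality is applied in
      direction \<open>u\<close>.\<close>
    have inner: "norm (dir_deriv u f (x + a *\<^sub>R u + t *\<^sub>R v) - dir_deriv u f (x + a *\<^sub>R u) - of_real t * c) \<le> e * t"
      if a: "0 \<le> a" "a \<le> t" for a
    proof -
      let ?g = "\<lambda>s. dir_deriv u f (x + a *\<^sub>R u + s *\<^sub>R v) - s *\<^sub>R c"
      have "norm (?g t - ?g 0) \<le> e * t"
      proof (rule norm_diff_le_vector_derivative)
        fix s :: real assume s: "0 \<le> s" "s \<le> t"
        show "(?g has_vector_derivative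
            dir_deriv v (dir_deriv u f) (x + a *\<^sub>R u + s *\<^sub>R v) - c) (at s)"
          by (auto intro!: derivative_eq_intros smooth_has_vector_derivative_line[OF su])
        show "norm (dir_deriv v (dir_deriv u f) (x + a *\<^sub>R u + s *\<^sub>R v) - c) \<le> e"
          using r(2)[OF near[OF a s]] by (simp add: dist_norm)
      qed (use t in simp)
      then show ?thesis by (simp add: scaleR_conv_of_real algebra_simps)
    qed
    let ?h = "\<lambda>s. f ((x + t *\<^sub>R v) + s *\<^sub>R u) - f (x + s *\<^sub>R u) - s *\<^sub>R (of_real t * c)"
    have "norm (?h t - ?h 0) \<le> (e * t) * t"
    proof (rule norm_diff_le_vector_derivative)
      fix s :: real assume s: "0 \<le> s" "s \<le> t"
      show "(?h has_vector_derivative dir_deriv u f ((x + t *\<^sub>R v) + s *\<^sub>R u)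
          - dir_deriv u f (x + s *\<^sub>R u) - of_real t * c) (at s)"
        by (auto intro!: derivative_eq_intros smooth_has_vector_derivative_line[OF f])
      show "norm (dir_deriv u f ((x + t *\<^sub>R v) + s *\<^sub>R u)
          - dir_deriv u f (x + s *\<^sub>R u) - of_real t * c) \<le> e * t"
        using inner[OF s] by (simp add: algebra_simps)
    qed (use t in simp)
    moreover have "x + t *\<^sub>R v + t *\<^sub>R u = x + t *\<^sub>R u + t *\<^sub>R v" by simp
    ultimately show ?thesis by (simp add: scaleR_conv_of_real algebra_simps)
  qed
  show ?thesis using d main unfolding c_def by blast
qed

text \<open>\<open>partial_deriv\<close> fixes the order of differentiation, whereas the chain rule
  produces derivatives in any order; this is what allows them to be sorted.\<close>

lemma dir_deriv_commute:
  fixes f :: "'a::real_normed_vector \<Rightarrow> complex"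
  assumes f: "smooth_on UNIV f"
  shows "dir_deriv u (dir_deriv v f) = dir_deriv v (dir_deriv u f)"
proof
  fix x
  define p where "p = dir_deriv u (dir_deriv v f) x"
  define q where "q = dir_deriv v (dir_deriv u f) x"
  have "norm (p - q) \<le> e" if e: "e > 0" for e
  proof -
    obtain d1 where d1: "d1 > 0" "\<And>t. 0 < t \<Longrightarrow> t < d1 \<Longrightarrow>
      norm (f (x + t *\<^sub>R u + t *\<^sub>R v) - f (x + t *\<^sub>R u) - f (x + t *\<^sub>R v) + f x
        - of_real (t * t) * q) \<le> (e/2) * (t * t)"
      using second_difference_approx[OF f, of "e/2" x u v] e unfolding q_def by auto
    obtain d2 where d2: "d2 > 0" "\<And>t. 0 < t \<Longrightarrow> t < d2 \<Longrightarrow>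
      norm (f (x + t *\<^sub>R v + t *\<^sub>R u) - f (x + t *\<^sub>R v) - f (x + t *\<^sub>R u) + f x
        - of_real (t * t) * p) \<le> (e/2) * (t * t)"
      using second_difference_approx[OF f, of "e/2" x v u] e unfolding p_def by auto
    define t where "t = min d1 d2 / 2"
    have t: "0 < t" "t < d1" "t < d2" using d1(1) d2(1) by (auto simp: t_def)
    define G where "G = f (x + t *\<^sub>R u + t *\<^sub>R v) - f (x + t *\<^sub>R u) - f (x + t *\<^sub>R v) + f x"
    have "x + t *\<^sub>R v + t *\<^sub>R u = x + t *\<^sub>R u + t *\<^sub>R v" by simp
    then have 1: "norm (G - of_real (t * t) * q) \<le> (e/2) * (t * t)"
      and 2: "norm (G - of_real (t * t) * p) \<le> (e/2) * (t * t)"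
      using d1(2)[OF t(1,2)] d2(2)[OF t(1,3)] by (simp_all add: G_def algebra_simps)
    have "norm ((G - of_real (t * t) * q) - (G - of_real (t * t) * p)) \<le> e * (t * t)"
      using norm_triangle_ineq4[of "G - of_real (t * t) * q" "G - of_real (t * t) * p"] 1 2
      by simp
    also have "(G - of_real (t * t) * q) - (G - of_real (t * t) * p) = of_real (t * t) * (p - q)"
      by (simp add: algebra_simps)
    finally have "(t * t) * norm (p - q) \<le> (t * t) * e"
      using t by (simp add: norm_mult mult.commute)
    then show ?thesis using t by (simp only: mult_le_cancel_left_pos mult_pos_pos)
  qed
  then have "norm (p - q) \<le> 0" by (rule field_le_epsilon[of _ 0, simplified])
  then show "dir_deriv u (dir_deriv v f) x = dir_deriv v (dir_deriv u f) x"
    by (simp add: p_def q_def)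
qed

lemma dir_deriv_funpow_commute:
  fixes f :: "'a::real_normed_vector \<Rightarrow> complex"
  assumes f: "smooth_on UNIV f"
  shows "(dir_deriv u ^^ n) (dir_deriv v f) = dir_deriv v ((dir_deriv u ^^ n) f)"
  by (induction n) (auto simp: dir_deriv_commute smooth_dir_deriv_funpow f)

lemma dir_deriv_sum_basis:
  fixes f :: "real^2 \<Rightarrow> complex"
  assumes f: "smooth_on UNIV f"
  shows "dir_deriv v f x = of_real (v$1) * dir_deriv (axis 1 1) f x + of_real (v$2) * dir_deriv (axis 2 1) f x"
proof -
  interpret bounded_linear "\<lambda>w. dir_deriv w f x"
    using smooth_has_derivative[OF f] by (rule has_derivative_bounded_linear)
  have "v = (v$1) *\<^sub>R axis 1 1 + (v$2) *\<^sub>R axis 2 1"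
    by (simp add: vec_eq_iff forall_2 axis_def)
  then have "dir_deriv v f x = dir_deriv ((v$1) *\<^sub>R axis 1 1 + (v$2) *\<^sub>R axis 2 1) f x" by simp
  also have "\<dots> = (v$1) *\<^sub>R dir_deriv (axis 1 1) f x + (v$2) *\<^sub>R dir_deriv (axis 2 1) f x"
    by (simp only: add scaleR)
  finally show ?thesis by (simp add: scaleR_conv_of_real)
qed

section \<open>Uniform first and second order remainder estimates\<close>

lemma smooth_lipschitz:
  fixes f :: "'a::real_normed_vector \<Rightarrow> complex"
  assumes f: "smooth_on UNIV f" and b: "\<And>x v. norm (dir_deriv v f x) \<le> L * norm v"
    and L: "0 \<le> L"
  shows "norm (f y - f x) \<le> L * norm (y - x)"
proof (rule differentiable_bound[where S = UNIV])
  fix z :: 'a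
  show "(f has_derivative (\<lambda>v. dir_deriv v f z)) (at z within UNIV)"
    using smooth_has_derivative[OF f] by simp
  show "onorm (\<lambda>v. dir_deriv v f z) \<le> L" using b L by (intro onorm_bound)
qed auto

text \<open>The constant depends neither on \<open>x\<close> nor on \<open>h\<close>, so that the
  remainder can later be integrated over the group. The usual factor 1/2 is lost because the bound
  linear in \<open>s\<close> on the change of the derivative is replaced by its value at
  \<open>s = 1\<close>.\<close>

lemma smooth_taylor:
  fixes f :: "'a::real_normed_vector \<Rightarrow> complex"
  assumes f: "smooth_on UNIV f"
    and b: "\<And>x u v. norm (dir_deriv u (dir_deriv v f) x) \<le> L * norm u * norm v"
    and L: "0 \<le> L"
  shows "norm (f (x + h) - f x - dir_deriv h f x) \<le> L * (norm h)\<^sup>2"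
proof -
  let ?g = "\<lambda>t. f (x + t *\<^sub>R h) - t *\<^sub>R dir_deriv h f x"
  have "norm (?g 1 - ?g 0) \<le> (L * norm h * norm h) * 1"
  proof (rule norm_diff_le_vector_derivative)
    fix s :: real assume s: "0 \<le> s" "s \<le> 1"
    show "(?g has_vector_derivative dir_deriv h f (x + s *\<^sub>R h) - dir_deriv h f x) (at s)"
      by (auto intro!: derivative_eq_intros smooth_has_vector_derivative_line[OF f])
    have "norm (dir_deriv h f (x + s *\<^sub>R h) - dir_deriv h f x) \<le> (L * norm h) * norm ((x + s *\<^sub>R h) - x)"
      by (rule smooth_lipschitz[OF smooth_dir_deriv[OF f]]) (use b L in \<open>simp_all add: mult_ac\<close>)
    also have "\<dots> = (L * norm h * norm h) * s" using s by simp
    also have "\<dots> \<le> (L * norm h * norm h) * 1" using s L by (intro mult_left_mono) auto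
    finally show "norm (dir_deriv h f (x + s *\<^sub>R h) - dir_deriv h f x) \<le> L * norm h * norm h" by simp
  qed simp
  then show ?thesis by (simp add: power2_eq_square algebra_simps)
qed

subsection \<open>The bracket and its integrability\<close>

lemma jbracket_ge_1: "1 \<le> jbracket x"
  unfolding jbracket_def by simp

lemma jbracket_pos: "0 < jbracket x"
  using jbracket_ge_1[of x] by linarith

lemma norm_le_jbracket: "norm x \<le> jbracket x"
  unfolding jbracket_def by (rule real_le_rsqrt) simp

lemma jbracket_le: "jbracket x \<le> 1 + norm x"
  unfolding jbracket_def by (rule real_le_lsqrt) (auto simp: power2_eq_square algebra_simps)

text \<open>A crude form of Peetre's inequality: \<open>1 + norm x\<close> is at most twice the
  bracket, once for each argument.\<close>

lemma jbracket_add_le: "jbracket (x + y) \<le> 4 * jbracket x * jbracket y"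
proof -
  have "jbracket (x + y) \<le> 1 + (norm x + norm y)"
    using jbracket_le[of "x + y"] norm_triangle_ineq[of x y] by linarith
  also have "\<dots> \<le> (1 + norm x) * (1 + norm y)" by (simp add: algebra_simps)
  also have "\<dots> \<le> (2 * jbracket x) * (2 * jbracket y)"
    using norm_le_jbracket[of x] norm_le_jbracket[of y] jbracket_ge_1[of x] jbracket_ge_1[of y]
    by (intro mult_mono) (auto intro: add_nonneg_nonneg)
  finally show ?thesis by simp
qed

lemma jbracket_measurable [measurable]:
  "(jbracket :: 'a::{second_countable_topology,real_normed_vector} \<Rightarrow> real) \<in> borel_measurable borel"
  unfolding jbracket_def[abs_def] by measurable

text \<open>Expanding the product of the two radicands leaves a nonnegative mixed term. Decay in
  separate variables thereby yields decay on a product space.\<close>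

lemma jbracket_Pair_le: "jbracket (x, y) \<le> jbracket x * jbracket y"
  unfolding jbracket_def real_sqrt_mult[symmetric]
  by (intro real_sqrt_le_mono)
    (auto simp: norm_Pair algebra_simps)

text \<open>The layer \<open>n \<le> norm x < n + 1\<close> lies in a ball of
  volume \<open>O(n ^ d)\<close>.\<close>

lemma integrable_inverse_jbracket_power:
  assumes "K = DIM('a::euclidean_space) + 2"
  shows "integrable lborel (\<lambda>x::'a. 1 / jbracket x ^ K)"
proof -
  let ?d = "DIM('a)" let ?V = "unit_ball_vol (real ?d)"
  \<comment> \<open>A full ball replaces the layer, since its volume is explicit; summability
    survives the overlap.\<close>
  define g :: "nat \<Rightarrow> 'a \<Rightarrow> ennreal" where
    "g n x = ennreal (2 ^ K / real (Suc n) ^ K) * indicator (cball 0 (real (Suc n))) x" for n x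
  have le: "ennreal (norm (1 / jbracket x ^ K)) \<le> (\<Sum>n. g n x)" for x :: 'a
  proof -
    define n where "n = nat \<lfloor>norm x\<rfloor>"
    have n: "real n \<le> norm x" "norm x \<le> real (Suc n)" unfolding n_def by (simp_all add: le_nat_iff) linarith
    have "real (Suc n) / 2 \<le> jbracket x"
      using n(1) norm_le_jbracket[of x] jbracket_ge_1[of x] by simp
    then have "(real (Suc n) / 2) ^ K \<le> jbracket x ^ K" by (intro power_mono) auto
    then have "1 / jbracket x ^ K \<le> 1 / (real (Suc n) / 2) ^ K"
      using jbracket_pos[of x] by (intro divide_left_mono) auto
    also have "\<dots> = 2 ^ K / real (Suc n) ^ K" by (simp add: power_divide)
    finally have "ennreal (norm (1 / jbracket x ^ K)) \<le> g n x"
      using n(2) jbracket_pos[of x] by (simp add: g_def ennreal_leI)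
    also have "\<dots> \<le> (\<Sum>n. g n x)"
      using sum_le_suminf[of "\<lambda>n. g n x" "{n}"] by simp
    finally show ?thesis .
  qed
  have "(\<integral>\<^sup>+ x. ennreal (norm (1 / jbracket x ^ K)) \<partial>(lborel :: 'a measure)) \<le> (\<integral>\<^sup>+ x. (\<Sum>n. g n x) \<partial>lborel)"
    by (intro nn_integral_mono le)
  also have "\<dots> = (\<Sum>n. \<integral>\<^sup>+ x. g n x \<partial>lborel)"
    by (intro nn_integral_suminf) (auto simp: g_def intro!: borel_measurable_times_ennreal borel_measurable_indicator)
  \<comment> \<open>The exponent exceeds the dimension by 2, so the volume growth of the balls
    leaves exactly the inverse squares.\<close>
  also have "\<dots> = (\<Sum>n. ennreal (2 ^ K * ?V * (1 / real (Suc n) ^ 2)))"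
  proof (intro suminf_cong)
    fix n
    have "(\<integral>\<^sup>+ x. g n x \<partial>lborel) = ennreal (2 ^ K / real (Suc n) ^ K) * ennreal (?V * real (Suc n) ^ ?d)"
      unfolding g_def by (subst nn_integral_cmult_indicator) (auto simp: emeasure_cball)
    also have "\<dots> = ennreal (2 ^ K / real (Suc n) ^ K * (?V * real (Suc n) ^ ?d))"
      by (rule ennreal_mult[symmetric]) auto
    also have "2 ^ K / real (Suc n) ^ K * (?V * real (Suc n) ^ ?d) = 2 ^ K * ?V * (1 / real (Suc n) ^ 2)"
      unfolding assms power_add by (simp add: field_simps del: of_nat_Suc power_Suc)
    finally show "(\<integral>\<^sup>+ x. g n x \<partial>lborel) = ennreal (2 ^ K * ?V * (1 / real (Suc n) ^ 2))" .
  qed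
  also have "\<dots> < \<infinity>"
  proof -
    have "summable (\<lambda>n. 2 ^ K * ?V * (1 / real (Suc n) ^ 2))"
      using inverse_power_summable[of 2, where 'a = real]
      by (intro summable_mult, subst summable_Suc_iff) (simp add: field_simps)
    then show ?thesis
      by (subst suminf_ennreal2) auto
  qed
  finally show ?thesis
    by (intro integrableI_bounded) auto
qed

subsection \<open>Shearlet coordinates and the weight on the group\<close>

text \<open>The vector \<open>M y\<close> written out in coordinates. Since division by 0 gives 0,
  it is the zero map at \<open>a = 0\<close>, so it is defined and measurable on the whole ambient
  space.\<close>

definition shearlet_coord :: "real \<Rightarrow> real \<Rightarrow> real ^ 2 \<Rightarrow> real ^ 2" where
  "shearlet_coord s a y =
     ((y $ 1 + s * y $ 2) / a) *\<^sub>R axis 1 1 + (sqrt \<bar>a\<bar> * y $ 2 / a) *\<^sub>R axis 2 1"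

text \<open>At \<open>a = 0\<close> the last factor is 0 by the convention for division, so the
  weight is at least 1 exactly where it is used, on the group, and vanishes elsewhere.\<close>

definition shearlet_weight :: "(real ^ 2) \<times> real \<times> real \<Rightarrow> real" where
  "shearlet_weight = (\<lambda>(b, s, a). jbracket b * jbracket s * (\<bar>a\<bar> + 1 / \<bar>a\<bar>))"

lemma shearlet_coord_nth [simp]:
  "shearlet_coord s a y $ 1 = (y $ 1 + s * y $ 2) / a"
  "shearlet_coord s a y $ 2 = sqrt \<bar>a\<bar> * y $ 2 / a"
  by (simp_all add: shearlet_coord_def axis_def)

lemma matrix_inv_eqI:
  fixes A :: "'a::semiring_1 ^ 'n ^ 'm"
  assumes "A ** B = mat 1" "B ** A = mat 1"
  shows "matrix_inv A = B"
proof -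
  have "A ** matrix_inv A = mat 1 \<and> matrix_inv A ** A = mat 1"
    unfolding matrix_inv_def by (rule someI[of _ B]) (use assms in simp)
  then show ?thesis by (metis assms(2) matrix_mul_assoc matrix_mul_lid matrix_mul_rid)
qed

lemma shearlet_rep_eq:
  assumes a: "a \<noteq> 0"
  shows "shearlet_rep b s a \<psi> x =
    complex_of_real (\<bar>a\<bar> powr (- 3 / 4)) * \<psi> (shearlet_coord s a (x - b))"
proof -
  have "dilation_matrix a ** (vector [vector [1 / a, 0], vector [0, sqrt \<bar>a\<bar> / a]] :: real^2^2) = mat 1"
    "(vector [vector [1 / a, 0], vector [0, sqrt \<bar>a\<bar> / a]] :: real^2^2) ** dilation_matrix a = mat 1"
    using a by (simp_all add: dilation_matrix_def matrix_matrix_mult_def vec_eq_iff forall_2 sum_2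
       mat_def powr_minus powr_half_sqrt divide_simps)
  then have "matrix_inv (dilation_matrix a) = vector [vector [1 / a, 0], vector [0, sqrt \<bar>a\<bar> / a]]"
    by (rule matrix_inv_eqI)
  moreover have "shear_matrix s ** (vector [vector [1, s], vector [0, 1]] :: real^2^2) = mat 1"
    "(vector [vector [1, s], vector [0, 1]] :: real^2^2) ** shear_matrix s = mat 1"
    by (simp_all add: shear_matrix_def matrix_matrix_mult_def vec_eq_iff forall_2 sum_2 mat_def)
  then have "matrix_inv (shear_matrix s) = vector [vector [1, s], vector [0, 1]]"
    by (rule matrix_inv_eqI)
  ultimately have "matrix_inv (dilation_matrix a) *v (matrix_inv (shear_matrix s) *v (x - b)) = shearlet_coord s a (x - b)"
    by (simp add: matrix_vector_mult_def vec_eq_iff forall_2 sum_2 add_divide_distrib)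
  then show ?thesis by (simp add: shearlet_rep_def)
qed

lemma linear_shearlet_coord: "linear (shearlet_coord s a)"
  by (rule linearI) (auto simp: vec_eq_iff forall_2 field_simps add_divide_distrib)

text \<open>Up to the shear parameter, the entries of \<open>M\<close> and of its inverse have
  modulus \<open>r\<close>, \<open>1 / r\<close>, \<open>sqrt r\<close> or \<open>sqrt r / r\<close>
  with \<open>r = |a|\<close>. One symmetric weight dominates them all; the case of
  \<open>sqrt r / r\<close> is that of \<open>sqrt r\<close> at \<open>1 / r\<close>.\<close>

lemma sqrt_le_add_inverse:
  fixes r :: real assumes "r > 0"
  shows "sqrt r \<le> r + 1 / r" "sqrt r / r \<le> r + 1 / r" "1 \<le> r + 1 / r"
proof -
  have *: "sqrt t \<le> t + 1 / t \<and> 1 \<le> t + 1 / t" if "t > 0" for t :: real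
  proof (cases "t \<ge> 1")
    case True
    then have "sqrt t \<le> t" by (intro real_le_lsqrt) (auto simp: power2_eq_square mult_left_mono)
    moreover have "0 < 1 / t" using that by simp
    ultimately show ?thesis using True by linarith
  next
    case False
    then have "sqrt t \<le> 1" "1 \<le> 1 / t" using that by (auto simp: field_simps)
    then show ?thesis using that by linarith
  qed
  show "sqrt r \<le> r + 1 / r" "1 \<le> r + 1 / r" using *[OF assms] by auto
  have "sqrt r / r = sqrt (1 / r)" using assms
    by (simp add: real_sqrt_divide field_simps)
  also have "\<dots> \<le> 1 / r + 1 / (1 / r)" using *[of "1 / r"] assms by simp
  finally show "sqrt r / r \<le> r + 1 / r" by simp
qed

text \<open>The mixed term of the square on the right is 2, which covers the 1 under the
  root.\<close>

lemma jbracket_le_add_inverse: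
  fixes a :: real
  assumes a: "a \<noteq> 0"
  shows "jbracket a \<le> \<bar>a\<bar> + 1 / \<bar>a\<bar>"
proof -
  have "(\<bar>a\<bar> + 1 / \<bar>a\<bar>)\<^sup>2 = \<bar>a\<bar>\<^sup>2 + (1 / \<bar>a\<bar>)\<^sup>2 + 2"
    using a unfolding power2_sum by simp
  then have "1 + \<bar>a\<bar>\<^sup>2 \<le> (\<bar>a\<bar> + 1 / \<bar>a\<bar>)\<^sup>2" using zero_le_power2[of "1 / \<bar>a\<bar>"] by linarith
  then show ?thesis unfolding jbracket_def by (intro real_le_lsqrt) auto
qed

lemma shearlet_weight_nonneg: "0 \<le> shearlet_weight p"
  by (cases p) (auto simp: shearlet_weight_def intro!: mult_nonneg_nonneg less_imp_le[OF jbracket_pos])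

context
  fixes b :: "real ^ 2" and s a :: real
  assumes a: "a \<noteq> 0"
begin

text \<open>All three factors of the weight are at least 1, so it dominates each of their partial
  products. The first bound is the one that turns powers of the weight into integrability on the
  ambient space.\<close>

lemma shearlet_weight_ge:
  shows "jbracket (b, s, a) \<le> shearlet_weight (b, s, a)"
    "1 \<le> shearlet_weight (b, s, a)"
    "jbracket b \<le> shearlet_weight (b, s, a)"
    "jbracket s * (\<bar>a\<bar> + 1 / \<bar>a\<bar>) \<le> shearlet_weight (b, s, a)"
    "\<bar>a\<bar> + 1 / \<bar>a\<bar> \<le> shearlet_weight (b, s, a)"
proof -
  let ?r = "\<bar>a\<bar> + 1 / \<bar>a\<bar>"
  have r: "1 \<le> ?r" using sqrt_le_add_inverse(3)[of "\<bar>a\<bar>"] a by simp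
  note j = jbracket_ge_1[of b] jbracket_ge_1[of s]
  have "jbracket (b, s, a) \<le> jbracket b * (jbracket s * jbracket a)"
    using jbracket_Pair_le[of b "(s,a)"] jbracket_Pair_le[of s a] jbracket_pos[of b]
    by (meson less_imp_le mult_left_mono order_trans)
  also have "\<dots> \<le> jbracket b * (jbracket s * ?r)"
    using j jbracket_le_add_inverse[OF a] by (intro mult_left_mono) auto
  finally show 1: "jbracket (b, s, a) \<le> shearlet_weight (b, s, a)"
    by (simp add: shearlet_weight_def mult.assoc)
  show "1 \<le> shearlet_weight (b, s, a)" using 1 jbracket_ge_1[of "(b,s,a)"] by linarith
  have 2: "1 * ?r \<le> jbracket s * ?r" using j r by (intro mult_right_mono) auto
  have 3: "1 * (jbracket s * ?r) \<le> jbracket b * (jbracket s * ?r)"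
    using j r 2 by (intro mult_right_mono) auto
  show "jbracket s * ?r \<le> shearlet_weight (b, s, a)"
    using 3 by (simp add: shearlet_weight_def mult.assoc)
  then show "?r \<le> shearlet_weight (b, s, a)" using 2 by simp
  have "1 \<le> jbracket s * ?r" using 2 unfolding mult_1 by (rule order_trans[OF r])
  then have "jbracket b * 1 \<le> jbracket b * (jbracket s * ?r)"
    using j by (intro mult_left_mono) auto
  then show "jbracket b \<le> shearlet_weight (b, s, a)"
    by (simp add: shearlet_weight_def mult.assoc)
qed

lemma shearlet_coeff_bounds:
  shows "\<bar>(v $ 1 + s * v $ 2) / a\<bar> \<le> 2 * norm v * shearlet_weight (b, s, a)"
    "\<bar>sqrt \<bar>a\<bar> * v $ 2 / a\<bar> \<le> 2 * norm v * shearlet_weight (b, s, a)"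
    and norm_shearlet_coord_le: "norm (shearlet_coord s a v) \<le> 4 * norm v * shearlet_weight (b, s, a)"
proof -
  let ?r = "\<bar>a\<bar> + 1 / \<bar>a\<bar>"
  have v: "\<bar>v $ 1\<bar> \<le> norm v" "\<bar>v $ 2\<bar> \<le> norm v" by (auto simp: component_le_norm_cart)
  have "\<bar>v $ 1 + s * v $ 2\<bar> \<le> norm v + \<bar>s\<bar> * norm v"
    using v mult_left_mono[OF v(2), of "\<bar>s\<bar>"] abs_triangle_ineq[of "v$1" "s * v $ 2"]
    by (simp add: abs_mult)
  also have "\<dots> \<le> 2 * norm v * jbracket s"
    using mult_left_mono[OF jbracket_ge_1[of s], of "norm v"]
      mult_left_mono[OF norm_le_jbracket[of s], of "norm v"] by (simp add: algebra_simps)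
  finally have "\<bar>(v $ 1 + s * v $ 2) / a\<bar> \<le> (2 * norm v * jbracket s) * (1 / \<bar>a\<bar>)"
    using a by (simp add: divide_simps)
  also have "\<dots> \<le> (2 * norm v * jbracket s) * ?r"
    using jbracket_ge_1[of s] by (intro mult_left_mono) auto
  also have "\<dots> = 2 * norm v * (jbracket s * ?r)" by simp
  also have "\<dots> \<le> 2 * norm v * shearlet_weight (b, s, a)"
    by (intro mult_left_mono shearlet_weight_ge(4)) auto
  finally show 1: "\<bar>(v $ 1 + s * v $ 2) / a\<bar> \<le> 2 * norm v * shearlet_weight (b, s, a)" .
  have "\<bar>sqrt \<bar>a\<bar> * v $ 2 / a\<bar> = \<bar>v $ 2\<bar> * (sqrt \<bar>a\<bar> / \<bar>a\<bar>)"
    by (simp add: abs_mult)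
  also have "\<dots> \<le> norm v * shearlet_weight (b, s, a)"
    using v sqrt_le_add_inverse(2)[of "\<bar>a\<bar>"] a shearlet_weight_ge(5)
    by (intro mult_mono) auto
  also have "\<dots> \<le> 2 * norm v * shearlet_weight (b, s, a)"
    using shearlet_weight_nonneg[of "(b,s,a)"] by (simp add: mult_right_mono)
  finally show 2: "\<bar>sqrt \<bar>a\<bar> * v $ 2 / a\<bar> \<le> 2 * norm v * shearlet_weight (b, s, a)" .
  have "norm (shearlet_coord s a v) \<le> \<bar>shearlet_coord s a v $ 1\<bar> + \<bar>shearlet_coord s a v $ 2\<bar>"
    using norm_le_l1_cart[of "shearlet_coord s a v"] by (simp add: sum_2)
  then show "norm (shearlet_coord s a v) \<le> 4 * norm v * shearlet_weight (b, s, a)"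
    using 1 2 by simp
qed

text \<open>Invert \<open>M\<close> by back substitution: \<open>y $ 2\<close> is a multiple of
  \<open>?z $ 2\<close> free of \<open>s\<close>, and \<open>y $ 1 = a * ?z $ 1 - s * y $ 2\<close>.
  Hence \<open>s\<close> enters only once and a single power of the weight is enough; the factor 3
  comes from \<open>2 + |s|\<close>.\<close>

lemma norm_le_shearlet_coord:
  "norm y \<le> 3 * shearlet_weight (b, s, a) * norm (shearlet_coord s a y)"
proof -
  let ?r = "\<bar>a\<bar> + 1 / \<bar>a\<bar>"
  let ?z = "shearlet_coord s a y"
  have z: "\<bar>?z $ 1\<bar> \<le> norm ?z" "\<bar>?z $ 2\<bar> \<le> norm ?z" by (rule component_le_norm_cart)+
  have "\<bar>y $ 2\<bar> = sqrt \<bar>a\<bar> * \<bar>?z $ 2\<bar>"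
    using a by (simp add: abs_mult mult.assoc[symmetric])
  also have "\<dots> \<le> ?r * norm ?z"
    using sqrt_le_add_inverse(1)[of "\<bar>a\<bar>"] a z by (intro mult_mono) auto
  finally have y2: "\<bar>y $ 2\<bar> \<le> ?r * norm ?z" .
  have "y $ 1 = a * ?z $ 1 - s * y $ 2" using a by simp
  then have "\<bar>y $ 1\<bar> \<le> \<bar>a\<bar> * \<bar>?z $ 1\<bar> + \<bar>s\<bar> * \<bar>y $ 2\<bar>"
    using abs_triangle_ineq4[of "a * ?z $ 1" "s * y $ 2"] by (simp only: abs_mult)
  also have "\<dots> \<le> ?r * norm ?z + \<bar>s\<bar> * (?r * norm ?z)"
    by (intro add_mono mult_mono z y2) (auto intro: mult_nonneg_nonneg)
  finally have "\<bar>y $ 1\<bar> + \<bar>y $ 2\<bar> \<le> (?r * norm ?z + \<bar>s\<bar> * (?r * norm ?z)) + ?r * norm ?z"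
    using y2 by (rule add_mono)
  also have "\<dots> = (2 + \<bar>s\<bar>) * (?r * norm ?z)" by (simp only: distrib_right) simp
  also have "\<dots> \<le> (3 * jbracket s) * (?r * norm ?z)"
    using jbracket_ge_1[of s] norm_le_jbracket[of s]
    by (intro mult_right_mono) (auto intro: mult_nonneg_nonneg)
  also have "\<dots> = 3 * (jbracket s * ?r) * norm ?z" by (simp add: mult_ac)
  also have "\<dots> \<le> 3 * shearlet_weight (b, s, a) * norm ?z"
    by (intro mult_right_mono mult_left_mono shearlet_weight_ge(4)) auto
  finally show ?thesis using norm_le_l1_cart[of y] by (simp add: sum_2)
qed

text \<open>One power of the weight undoes \<open>M\<close>, the other undoes the translation by
  \<open>b\<close>. Each of the two steps contributes a factor 4.\<close>

lemma jbracket_le_shearlet_coord: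
  "jbracket x \<le> 16 * shearlet_weight (b, s, a) ^ 2 * jbracket (shearlet_coord s a (x - b))"
proof -
  let ?q = "shearlet_weight (b, s, a)" let ?z = "shearlet_coord s a (x - b)"
  have q: "1 \<le> ?q" by (rule shearlet_weight_ge)
  have "jbracket (x - b) \<le> 1 + 3 * ?q * norm ?z"
    using jbracket_le[of "x - b"] norm_le_shearlet_coord[of "x - b"] by linarith
  also have "\<dots> \<le> ?q * jbracket ?z + 3 * ?q * jbracket ?z"
    using q jbracket_ge_1[of ?z] norm_le_jbracket[of ?z] mult_mono[of 1 ?q 1 "jbracket ?z"]
    by (intro add_mono mult_left_mono) auto
  finally have 1: "jbracket (x - b) \<le> 4 * ?q * jbracket ?z" by simp
  have "jbracket x \<le> 4 * jbracket b * jbracket (x - b)"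
    using jbracket_add_le[of b "x - b"] by simp
  also have "\<dots> \<le> (4 * ?q) * (4 * ?q * jbracket ?z)"
    using 1 shearlet_weight_ge(3) q jbracket_pos[of "x - b"] jbracket_pos[of b]
    by (intro mult_mono) auto
  finally show ?thesis by (simp add: power2_eq_square mult_ac)
qed

end

subsection \<open>Linear changes of variables\<close>

text \<open>Lebesgue measure is characterized by its values on boxes. The preimage of a box under
  \<open>g\<close> is its image under the inverse \<open>h\<close>, whose measure is scaled by the
  determinant of \<open>h\<close>.\<close>

lemma distr_linear_lborel:
  fixes g :: "real ^ 'n::{finite,wellorder} \<Rightarrow> real ^ 'n::_"
  assumes g: "linear g" "inj g"
  shows "distr lborel borel g = density lborel (\<lambda>_. ennreal (1 / \<bar>det (matrix g)\<bar>))"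
proof -
  obtain h where h: "linear h" "h \<circ> g = id" "g \<circ> h = id"
    using linear_injective_isomorphism[OF g] by (auto simp: fun_eq_iff)
  have d: "det (matrix g) \<noteq> 0" using det_nz_iff_inj[OF g(1)] g(2) by simp
  have "matrix h ** matrix g = mat 1"
    using matrix_compose[OF g(1) h(1)] h(2) by (simp add: matrix_id_mat_1)
  then have dh: "det (matrix h) * det (matrix g) = 1"
    by (metis det_I det_mul)
  have gm [measurable]: "g \<in> borel_measurable borel"
    using g(1) by (intro borel_measurable_continuous_onI linear_continuous_on) (simp add: linear_conv_bounded_linear)
  have "lborel = density (distr lborel borel g) (\<lambda>_. ennreal \<bar>det (matrix g)\<bar>)"
  proof (rule lborel_eqI)
    fix l u :: "real ^ 'n::_" assume lu: "\<And>b. b \<in> Basis \<Longrightarrow> l \<bullet> b \<le> u \<bullet> b"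
    have "g -` box l u = h ` box l u"
      using h(2,3) by (auto simp: fun_eq_iff image_iff) metis
    moreover have lm: "box l u \<in> lmeasurable" by simp
    ultimately have 1: "g -` box l u \<in> lmeasurable"
      "measure lebesgue (g -` box l u) = \<bar>det (matrix h)\<bar> * measure lebesgue (box l u)"
      using measurable_linear_image[OF h(1) lm] measure_linear_image[OF h(1) lm] by auto
    have bor: "g -` box l u \<in> sets borel"
      using measurable_sets[OF gm, of "box l u"] by simp
    \<comment> \<open>The image formula concerns the completed measure; the two measures agree here
      because the preimage is a Borel set.\<close>
    have "emeasure lborel (g -` box l u) = emeasure lebesgue (g -` box l u)"
      using bor by simp
    also have "\<dots> = ennreal (\<bar>det (matrix h)\<bar> * measure lborel (box l u))"
      using 1 by (simp add: emeasure_eq_measure2)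
    finally have 2: "emeasure lborel (g -` box l u) = ennreal (\<bar>det (matrix h)\<bar> * measure lborel (box l u))" .
    have "emeasure (density (distr lborel borel g) (\<lambda>_. ennreal \<bar>det (matrix g)\<bar>)) (box l u) =
      ennreal \<bar>det (matrix g)\<bar> * emeasure lborel (g -` box l u)"
      by (simp add: emeasure_density nn_integral_cmult_indicator emeasure_distr)
    also have "\<dots> = ennreal (\<bar>det (matrix h) * det (matrix g)\<bar> * measure lborel (box l u))"
      unfolding 2 by (simp add: ennreal_mult[symmetric] abs_mult mult_ac)
    finally show "emeasure (density (distr lborel borel g) (\<lambda>_. ennreal \<bar>det (matrix g)\<bar>)) (box l u) =
        (\<Prod>b\<in>Basis. (u - l) \<bullet> b)"
      using lu by (simp add: dh measure_lborel_box_eq inner_diff_left)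
  qed simp
  then have "density lborel (\<lambda>_. ennreal (1 / \<bar>det (matrix g)\<bar>)) =
    density (density (distr lborel borel g) (\<lambda>_. ennreal \<bar>det (matrix g)\<bar>)) (\<lambda>_. ennreal (1 / \<bar>det (matrix g)\<bar>))"
    by simp
  also have "\<dots> = distr lborel borel g"
    using d by (simp add: density_density_eq ennreal_mult[symmetric] density_1)
  finally show ?thesis ..
qed

lemma integral_linear_lborel:
  fixes g :: "real ^ 'n::{finite,wellorder} \<Rightarrow> real ^ 'n::_" and f :: "real ^ 'n::_ \<Rightarrow> complex"
  assumes g: "linear g" "inj g" and f [measurable]: "f \<in> borel_measurable borel"
  shows "(LINT x|lborel. f (g x)) = (1 / \<bar>det (matrix g)\<bar>) *\<^sub>R (LINT x|lborel. f x)"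
proof -
  have gm [measurable]: "g \<in> borel_measurable borel"
    using g(1) by (intro borel_measurable_continuous_onI linear_continuous_on) (simp add: linear_conv_bounded_linear)
  have "(LINT x|lborel. f (g x)) = (LINT x|distr lborel borel g. f x)"
    by (simp add: integral_distr)
  also have "\<dots> = (1 / \<bar>det (matrix g)\<bar>) *\<^sub>R (LINT x|lborel. f x)"
    unfolding distr_linear_lborel[OF g] by (subst integral_density) auto
  finally show ?thesis .
qed

subsection \<open>Schwartz norms\<close>

lemma funpow_dir_deriv_le_schwartz_norm:
  fixes f :: "real ^ 2 \<Rightarrow> complex"
  assumes "schwartz_norm \<nu> f \<le> ennreal B" "0 \<le> B" "j + k \<le> \<nu>"
  shows "jbracket x ^ \<nu> * norm ((dir_deriv (axis 1 1) ^^ j) ((dir_deriv (axis 2 1) ^^ k) f) x) \<le> B"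
proof -
  define m :: "nat ^ 2" where "m = vector [j, k]"
  have m: "m $ 1 = j" "m $ 2 = k" by (simp_all add: m_def)
  have "ennreal (jbracket x ^ \<nu> * norm (partial_deriv m f x)) \<le> schwartz_norm \<nu> f"
    unfolding schwartz_norm_def by (rule SUP_upper2[of "(x, m)"]) (use assms(3) in \<open>auto simp: sum_2 m\<close>)
  also have "\<dots> \<le> ennreal B" by (rule assms(1))
  finally show ?thesis using assms(2) by (simp add: partial_deriv_def m)
qed

lemma schwartz_norm_leI:
  fixes f :: "real ^ 2 \<Rightarrow> complex"
  assumes "\<And>x j k. j + k \<le> \<nu> \<Longrightarrow>
    jbracket x ^ \<nu> * norm ((dir_deriv (axis 1 1) ^^ j) ((dir_deriv (axis 2 1) ^^ k) f) x) \<le> B"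
  shows "schwartz_norm \<nu> f \<le> ennreal B"
  unfolding schwartz_norm_def
proof (rule SUP_least, clarsimp)
  fix x and m :: "nat ^ 2" assume "(\<Sum>i\<in>UNIV. m $ i) \<le> \<nu>"
  then show "ennreal (jbracket x ^ \<nu> * norm (partial_deriv m f x)) \<le> ennreal B"
    unfolding partial_deriv_def by (intro ennreal_leI assms) (simp add: sum_2)
qed

lemma schwartz_norm_boundE:
  assumes "schwartz_norm \<nu> f < \<infinity>"
  obtains B where "0 \<le> B" "schwartz_norm \<nu> f = ennreal B"
  using assms by (cases "schwartz_norm \<nu> f") (auto simp: less_top[symmetric])

lemma schwartz_smooth: "f \<in> schwartz_space \<Longrightarrow> smooth_on UNIV f"
  unfolding schwartz_space_def by simp

lemma schwartz_norm_finite: "f \<in> schwartz_space \<Longrightarrow> schwartz_norm \<nu> f < \<infinity>"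
  unfolding schwartz_space_def by simp

text \<open>The index of \<open>schwartz_norm\<close> governs both weight and order. One more
  derivative therefore raises it by one, and the extra power of the bracket is given away.\<close>

lemma schwartz_norm_dir_deriv_le:
  fixes f :: "real ^ 2 \<Rightarrow> complex"
  assumes f: "smooth_on UNIV f" and e: "e = axis 1 1 \<or> e = axis 2 1"
  shows "schwartz_norm \<nu> (dir_deriv e f) \<le> schwartz_norm (Suc \<nu>) f"
proof (cases "schwartz_norm (Suc \<nu>) f < \<infinity>")
  case True
  then obtain B where B: "0 \<le> B" "schwartz_norm (Suc \<nu>) f = ennreal B" by (rule schwartz_norm_boundE)
  have "schwartz_norm \<nu> (dir_deriv e f) \<le> ennreal B"
  proof (rule schwartz_norm_leI)
    fix x j k assume jk: "j + k \<le> \<nu>"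
    let ?D = "\<lambda>j k f. (dir_deriv (axis 1 1) ^^ j) ((dir_deriv (axis (2::2) 1) ^^ k) f)"
    \<comment> \<open>A new derivative along the first axis must be commuted past those along the
      second; one along the second axis already stands innermost.\<close>
    have "\<exists>j' k'. j' + k' \<le> Suc \<nu> \<and> ?D j k (dir_deriv e f) = ?D j' k' f"
    proof (cases "e = axis 1 1")
      case True
      then have "?D j k (dir_deriv e f) = ?D (Suc j) k f"
        by (simp only: dir_deriv_funpow_commute[OF f] funpow_swap1[symmetric] funpow.simps o_def)
      then show ?thesis using jk by (intro exI[of _ "Suc j"] exI[of _ k]) simp
    next
      case False
      then have "?D j k (dir_deriv e f) = ?D j (Suc k) f"
        using e by (simp add: funpow_swap1)
      then show ?thesis using jk by (intro exI[of _ j] exI[of _ "Suc k"]) simp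
    qed
    then obtain j' k' where *: "j' + k' \<le> Suc \<nu>" "?D j k (dir_deriv e f) = ?D j' k' f" by blast
    have "jbracket x ^ \<nu> * norm (?D j' k' f x) \<le> jbracket x ^ Suc \<nu> * norm (?D j' k' f x)"
      by (intro mult_right_mono power_increasing jbracket_ge_1) auto
    also have "\<dots> \<le> B" by (rule funpow_dir_deriv_le_schwartz_norm) (use B * in auto)
    finally show "jbracket x ^ \<nu> * norm (?D j k (dir_deriv e f) x) \<le> B" unfolding * .
  qed
  then show ?thesis using B by simp
qed (simp add: less_top[symmetric])

lemma schwartz_dir_deriv:
  assumes "f \<in> schwartz_space" and e: "e = axis 1 1 \<or> e = axis 2 1"
  shows "dir_deriv e f \<in> schwartz_space"
  using assms schwartz_norm_dir_deriv_le[OF schwartz_smooth[OF assms(1)] e]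
  unfolding schwartz_space_def by (auto intro: smooth_dir_deriv le_less_trans)

lemma schwartz_bounded:
  assumes "f \<in> schwartz_space"
  obtains B where "0 \<le> B" "\<And>x. jbracket x ^ \<nu> * norm (f x) \<le> B"
proof -
  obtain B where "0 \<le> B" "schwartz_norm \<nu> f = ennreal B"
    using schwartz_norm_boundE schwartz_norm_finite[OF assms] by metis
  then show thesis using funpow_dir_deriv_le_schwartz_norm[of \<nu> f B 0 0] that by simp
qed

lemma schwartz_dir_deriv_bounded:
  assumes f: "f \<in> schwartz_space"
  obtains B where "0 \<le> B" "\<And>x v. norm (dir_deriv v f x) \<le> B * norm v"
proof -
  obtain B1 B2 where B: "0 \<le> B1" "\<And>x. norm (dir_deriv (axis 1 1) f x) \<le> B1"
      "0 \<le> B2" "\<And>x. norm (dir_deriv (axis 2 1) f x) \<le> B2"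
    using schwartz_bounded[OF schwartz_dir_deriv[OF f], of _ 0] by (metis (no_types, lifting) mult_1 power_0)
  have "norm (dir_deriv v f x) \<le> (B1 + B2) * norm v" for x v
  proof -
    have "norm (dir_deriv v f x) \<le> \<bar>v $ 1\<bar> * norm (dir_deriv (axis 1 1) f x) + \<bar>v $ 2\<bar> * norm (dir_deriv (axis 2 1) f x)"
      unfolding dir_deriv_sum_basis[OF schwartz_smooth[OF f], of v x]
      by (rule norm_triangle_le) (simp add: norm_mult)
    also have "\<dots> \<le> norm v * B1 + norm v * B2"
      by (intro add_mono mult_mono B component_le_norm_cart) auto
    finally show ?thesis by (simp add: algebra_simps)
  qed
  then show thesis using that[of "B1 + B2"] B by auto
qed

text \<open>Symmetry allows the outer direction to be expanded in the basis and moved inside, where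
  the first order bound applies to the two partial derivatives, which are again Schwartz
  functions.\<close>

lemma schwartz_second_dir_deriv_bounded:
  assumes f: "f \<in> schwartz_space"
  obtains B where "0 \<le> B" "\<And>x u v. norm (dir_deriv u (dir_deriv v f) x) \<le> B * norm u * norm v"
proof -
  obtain B1 where B1: "0 \<le> B1" "\<And>x v. norm (dir_deriv v (dir_deriv (axis 1 1) f) x) \<le> B1 * norm v"
    using schwartz_dir_deriv_bounded[OF schwartz_dir_deriv[OF f]] by metis
  obtain B2 where B2: "0 \<le> B2" "\<And>x v. norm (dir_deriv v (dir_deriv (axis 2 1) f) x) \<le> B2 * norm v"
    using schwartz_dir_deriv_bounded[OF schwartz_dir_deriv[OF f]] by metis
  note s = schwartz_smooth[OF f]
  have "norm (dir_deriv u (dir_deriv v f) x) \<le> (B1 + B2) * norm u * norm v" for x u v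
  proof -
    have "dir_deriv u (dir_deriv v f) x = of_real (u $ 1) * dir_deriv v (dir_deriv (axis 1 1) f) x
        + of_real (u $ 2) * dir_deriv v (dir_deriv (axis 2 1) f) x"
      unfolding dir_deriv_sum_basis[OF smooth_dir_deriv[OF s], of u]
      by (simp add: dir_deriv_commute[OF s, of _ v])
    then have "norm (dir_deriv u (dir_deriv v f) x) \<le> \<bar>u $ 1\<bar> * norm (dir_deriv v (dir_deriv (axis 1 1) f) x)
        + \<bar>u $ 2\<bar> * norm (dir_deriv v (dir_deriv (axis 2 1) f) x)"
      by (simp only:) (rule norm_triangle_le, simp add: norm_mult)
    also have "\<dots> \<le> norm u * (B1 * norm v) + norm u * (B2 * norm v)"
      by (intro add_mono mult_mono B1 B2 component_le_norm_cart) auto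
    finally show ?thesis by (simp add: algebra_simps)
  qed
  then show thesis using that[of "B1 + B2"] B1 B2 by auto
qed

subsection \<open>Superpositions of sheared and dilated functions\<close>

definition shearlet_arg :: "real ^ 2 \<Rightarrow> (real ^ 2) \<times> real \<times> real \<Rightarrow> real ^ 2" where
  "shearlet_arg x p = shearlet_coord (fst (snd p)) (snd (snd p)) (x - fst p)"

text \<open>The constant is an explicit parameter, so that estimates remain linear in it and finally
  in a norm of \<open>F\<close>.\<close>

definition decay_bound :: "nat \<Rightarrow> ((real ^ 2) \<times> real \<times> real \<Rightarrow> complex) \<Rightarrow> real \<Rightarrow> bool" where
  "decay_bound N W A \<longleftrightarrow> (\<forall>p. shearlet_weight p ^ N * norm (W p) \<le> A)"

definition rapid :: "((real ^ 2) \<times> real \<times> real \<Rightarrow> complex) set" where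
  "rapid = {W. W \<in> borel_measurable borel \<and> (\<forall>p. p \<notin> shearlet_group \<longrightarrow> W p = 0) \<and>
     (\<forall>N. \<exists>A. decay_bound N W A)}"

definition superposition ::
  "((real ^ 2) \<times> real \<times> real \<Rightarrow> complex) \<Rightarrow> (real ^ 2 \<Rightarrow> complex) \<Rightarrow> real ^ 2 \<Rightarrow> complex" where
  "superposition W \<phi> x = (LINT p|lborel. W p * \<phi> (shearlet_arg x p))"

text \<open>The exponent is the dimension 4 of the ambient space plus 2.\<close>

definition jbracket_integral :: real where
  "jbracket_integral = (LINT p|lborel. 1 / jbracket (p :: (real ^ 2) \<times> real \<times> real) ^ 6)"

lemma integrable_jbracket_group:
  "integrable lborel (\<lambda>p :: (real ^ 2) \<times> real \<times> real. 1 / jbracket p ^ 6)"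
  by (rule integrable_inverse_jbracket_power) simp

lemma jbracket_integral_nonneg: "0 \<le> jbracket_integral"
  unfolding jbracket_integral_def
  by (rule integral_nonneg_AE) (simp add: less_imp_le[OF jbracket_pos])

lemma rapid_measurable: "W \<in> rapid \<Longrightarrow> W \<in> borel_measurable borel"
  unfolding rapid_def by simp

lemma rapid_zero: "W \<in> rapid \<Longrightarrow> p \<notin> shearlet_group \<Longrightarrow> W p = 0"
  unfolding rapid_def by blast

lemma rapid_decay: "W \<in> rapid \<Longrightarrow> \<exists>A. decay_bound N W A"
  unfolding rapid_def by simp

lemma decay_bound_nonneg: "decay_bound N W A \<Longrightarrow> 0 \<le> A"
  unfolding decay_bound_def
  by (meson mult_nonneg_nonneg norm_ge_zero order_trans shearlet_weight_nonneg zero_le_power)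

lemma shearlet_weight_ge_1: "p \<in> shearlet_group \<Longrightarrow> 1 \<le> shearlet_weight p"
  by (auto simp: shearlet_group_def shearlet_weight_ge)

lemma decay_bound_mono:
  assumes W: "W \<in> rapid" and d: "decay_bound N W A" and n: "n \<le> N"
  shows "decay_bound n W A"
  unfolding decay_bound_def
proof
  fix p
  show "shearlet_weight p ^ n * norm (W p) \<le> A"
  proof (cases "p \<in> shearlet_group")
    case True
    then have "shearlet_weight p ^ n * norm (W p) \<le> shearlet_weight p ^ N * norm (W p)"
      by (intro mult_right_mono power_increasing n shearlet_weight_ge_1) auto
    then show ?thesis using d unfolding decay_bound_def by (meson order_trans)
  qed (use W decay_bound_nonneg[OF d] in \<open>simp add: rapid_zero\<close>)
qed

lemma measurable_vec_nth [measurable]: "(\<lambda>x. x $ i) \<in> borel_measurable (borel :: (real ^ 'n) measure)"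
  by (intro borel_measurable_continuous_onI continuous_intros)

lemma shearlet_arg_measurable [measurable]:
  "(\<lambda>z. shearlet_arg (fst z) (snd z)) \<in> borel_measurable borel"
  unfolding shearlet_arg_def shearlet_coord_def borel_prod[symmetric] by measurable

lemma shearlet_arg_measurable2 [measurable]: "shearlet_arg x \<in> borel_measurable borel"
  unfolding shearlet_arg_def[abs_def] shearlet_coord_def borel_prod[symmetric] by measurable

text \<open>Of the available powers of the weight, \<open>2 * \<nu>\<close> pay for moving the decay
  from \<phi> to \<open>x\<close>, and the remaining \<open>k\<close> become decay in the group
  variable. Off the group the left side is 0.\<close>

lemma superposition_kernel_bound:
  assumes W: "W \<in> rapid" and A: "decay_bound (2 * \<nu> + k) W A"
    and B: "\<And>z. jbracket z ^ \<nu> * norm (\<phi> z) \<le> B"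
  shows "jbracket x ^ \<nu> * norm (W p * \<phi> (shearlet_arg x p)) \<le> 16 ^ \<nu> * A * B / jbracket p ^ k"
proof (cases "p \<in> shearlet_group")
  case False
  have "0 \<le> B" using B[of 0] by (meson jbracket_pos less_imp_le mult_nonneg_nonneg norm_ge_zero order_trans zero_le_power)
  then show ?thesis
    using False W decay_bound_nonneg[OF A] jbracket_pos[of p] by (simp add: rapid_zero less_imp_le)
next
  case True
  then obtain b s a where p: "p = (b, s, a)" and a: "a \<noteq> 0" by (auto simp: shearlet_group_def)
  let ?q = "shearlet_weight p" let ?z = "shearlet_arg x p"
  have q: "1 \<le> ?q" by (rule shearlet_weight_ge_1[OF True])
  have "jbracket x \<le> 16 * ?q ^ 2 * jbracket ?z"
    using jbracket_le_shearlet_coord[OF a, of x b s] by (simp add: shearlet_arg_def p)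
  then have "jbracket x ^ \<nu> \<le> (16 * ?q ^ 2 * jbracket ?z) ^ \<nu>"
    using jbracket_pos[of x] by (intro power_mono) auto
  then have "jbracket x ^ \<nu> * norm (W p * \<phi> ?z) \<le> (16 * ?q ^ 2 * jbracket ?z) ^ \<nu> * norm (W p * \<phi> ?z)"
    by (rule mult_right_mono) simp
  also have "\<dots> = 16 ^ \<nu> * (?q ^ (2 * \<nu>) * norm (W p)) * (jbracket ?z ^ \<nu> * norm (\<phi> ?z))"
    by (simp add: power_mult_distrib norm_mult mult_ac flip: power_mult)
  also have "\<dots> \<le> 16 ^ \<nu> * (A / jbracket p ^ k) * B"
  proof (intro mult_mono B mult_nonneg_nonneg mult_left_mono)
    have "jbracket p ^ k * (?q ^ (2 * \<nu>) * norm (W p)) \<le> ?q ^ k * (?q ^ (2 * \<nu>) * norm (W p))"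
      using shearlet_weight_ge(1)[OF a, of b s] jbracket_pos[of p] q unfolding p
      by (intro mult_right_mono power_mono) auto
    also have "\<dots> = ?q ^ (2 * \<nu> + k) * norm (W p)" by (simp add: power_add mult_ac)
    also have "\<dots> \<le> A" using A unfolding decay_bound_def by blast
    finally show "?q ^ (2 * \<nu>) * norm (W p) \<le> A / jbracket p ^ k"
      using jbracket_pos[of p] by (simp add: field_simps)
  qed (use q jbracket_pos[of p] jbracket_pos[of ?z] decay_bound_nonneg[OF A] in auto)
  finally show ?thesis by simp
qed

lemma superposition_integrable:
  assumes W: "W \<in> rapid" and m [measurable]: "\<phi> \<in> borel_measurable borel"
    and B: "\<And>z. norm (\<phi> z) \<le> B"
  shows "integrable lborel (\<lambda>p. W p * \<phi> (shearlet_arg x p))"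
proof -
  note [measurable] = rapid_measurable[OF W]
  obtain A where A: "decay_bound (2 * 0 + 6) W A" using rapid_decay[OF W] by blast
  show ?thesis
  proof (rule Bochner_Integration.integrable_bound)
    show "integrable lborel (\<lambda>p :: (real ^ 2) \<times> real \<times> real. 16 ^ 0 * A * B * (1 / jbracket p ^ 6))"
      by (intro integrable_mult_right integrable_jbracket_group)
    show "AE p in lborel. norm (W p * \<phi> (shearlet_arg x p)) \<le> norm (16 ^ 0 * A * B * (1 / jbracket p ^ 6))"
      using superposition_kernel_bound[OF W A, of \<phi> B x] B
      by (intro AE_I2) (simp only: real_norm_def, rule order_trans[OF _ abs_ge_self], simp)
  qed measurable
qed

lemma schwartz_measurable: "\<phi> \<in> schwartz_space \<Longrightarrow> \<phi> \<in> borel_measurable borel"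
  by (intro borel_measurable_continuous_onI smooth_continuous schwartz_smooth)

lemma superposition_integrable_schwartz:
  assumes "W \<in> rapid" "\<phi> \<in> schwartz_space"
  shows "integrable lborel (\<lambda>p. W p * \<phi> (shearlet_arg x p))"
proof -
  obtain B where "\<And>x. jbracket x ^ 0 * norm (\<phi> x) \<le> B"
    using schwartz_bounded[OF assms(2)] by metis
  then show ?thesis
    using superposition_integrable[OF assms(1) schwartz_measurable[OF assms(2)], of B] by simp
qed

lemma norm_integral_le_jbracket_integral:
  fixes f :: "(real ^ 2) \<times> real \<times> real \<Rightarrow> complex"
  assumes "\<And>p. norm (f p) \<le> C / jbracket p ^ 6"
  shows "norm (LINT p|lborel. f p) \<le> C * jbracket_integral"
proof -
  have "norm (LINT p|lborel. f p) \<le> (LINT p|lborel. norm (f p))"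
    by (rule integral_norm_bound)
  also have "\<dots> \<le> (LINT p|lborel. C * (1 / jbracket (p :: (real ^ 2) \<times> real \<times> real) ^ 6))"
  proof (rule integral_mono_AE')
    show "integrable lborel (\<lambda>p :: (real ^ 2) \<times> real \<times> real. C * (1 / jbracket p ^ 6))"
      by (intro integrable_mult_right integrable_jbracket_group)
    show "AE p in lborel. 0 \<le> C * (1 / jbracket (p :: (real ^ 2) \<times> real \<times> real) ^ 6)"
      using order_trans[OF norm_ge_zero assms] by simp
  qed (use assms in simp)
  finally show ?thesis unfolding jbracket_integral_def by (simp only: integral_mult_right_zero)
qed

lemma superposition_bound:
  assumes W: "W \<in> rapid" and A: "decay_bound (2 * \<nu> + 6) W A"
    and B: "\<And>z. jbracket z ^ \<nu> * norm (\<phi> z) \<le> B"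
  shows "jbracket x ^ \<nu> * norm (superposition W \<phi> x) \<le> 16 ^ \<nu> * A * B * jbracket_integral"
proof -
  have j: "jbracket x ^ \<nu> > 0" using jbracket_pos[of x] by simp
  have "norm (superposition W \<phi> x) \<le> (16 ^ \<nu> * A * B / jbracket x ^ \<nu>) * jbracket_integral"
    unfolding superposition_def
  proof (rule norm_integral_le_jbracket_integral)
    fix p
    have "jbracket x ^ \<nu> * norm (W p * \<phi> (shearlet_arg x p)) \<le> 16 ^ \<nu> * A * B / jbracket p ^ 6"
      by (rule superposition_kernel_bound[OF W A B])
    then have "norm (W p * \<phi> (shearlet_arg x p)) \<le> 16 ^ \<nu> * A * B / jbracket p ^ 6 / jbracket x ^ \<nu>"
      by (subst pos_le_divide_eq[OF j]) (simp only: mult.commute)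
    then show "norm (W p * \<phi> (shearlet_arg x p)) \<le> 16 ^ \<nu> * A * B / jbracket x ^ \<nu> / jbracket p ^ 6"
      by (simp add: mult.commute)
  qed
  then show ?thesis using j by (simp add: field_simps)
qed

section \<open>Differentiation under the integral sign\<close>

definition shearlet_factor :: "2 \<Rightarrow> real ^ 2 \<Rightarrow> (real ^ 2) \<times> real \<times> real \<Rightarrow> real" where
  "shearlet_factor i v p = shearlet_coord (fst (snd p)) (snd (snd p)) v $ i"

lemma shearlet_factor_measurable [measurable]: "shearlet_factor i v \<in> borel_measurable borel"
  unfolding shearlet_factor_def[abs_def] shearlet_coord_def borel_prod[symmetric] by measurable

lemma shearlet_factor_le:
  assumes "p \<in> shearlet_group"
  shows "\<bar>shearlet_factor i v p\<bar> \<le> 2 * norm v * shearlet_weight p"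
proof -
  obtain b s a where p: "p = (b, s, a)" and a: "a \<noteq> 0" using assms by (auto simp: shearlet_group_def)
  show ?thesis
    using exhaust_2[of i] shearlet_coeff_bounds(1)[OF a, of v s b] shearlet_coeff_bounds(2)[OF a, of v b s]
    by (auto simp: p shearlet_factor_def)
qed

text \<open>A factor growing like the \<open>n\<close>-th power of the weight costs \<open>n\<close>
  orders of decay. It is applied with \<open>n = 1\<close> to the entries of \<open>M v\<close> from
  the chain rule and with \<open>n = 4\<close> to the powers of \<open>|a|\<close> in the synthesis
  integral.\<close>

lemma decay_bound_mult:
  assumes W: "W \<in> rapid" and d: "decay_bound (N + n) W A" and k: "0 \<le> k"
    and c: "\<And>p. p \<in> shearlet_group \<Longrightarrow> \<bar>c p\<bar> \<le> k * shearlet_weight p ^ n"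
  shows "decay_bound N (\<lambda>p. of_real (c p) * W p) (k * A)"
  unfolding decay_bound_def
proof
  fix p
  show "shearlet_weight p ^ N * norm (of_real (c p) * W p) \<le> k * A"
  proof (cases "p \<in> shearlet_group")
    case True
    have "shearlet_weight p ^ N * norm (of_real (c p) * W p) = \<bar>c p\<bar> * (shearlet_weight p ^ N * norm (W p))"
      by (simp add: norm_mult)
    also have "\<dots> \<le> (k * shearlet_weight p ^ n) * (shearlet_weight p ^ N * norm (W p))"
      by (intro mult_right_mono c True mult_nonneg_nonneg zero_le_power shearlet_weight_nonneg) auto
    also have "\<dots> = k * (shearlet_weight p ^ (N + n) * norm (W p))" by (simp add: power_add mult_ac)
    also have "\<dots> \<le> k * A"
      using d k unfolding decay_bound_def by (intro mult_left_mono) blast+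
    finally show ?thesis .
  qed (use W k decay_bound_nonneg[OF d] in \<open>simp add: rapid_zero\<close>)
qed

lemma rapid_mult:
  assumes W: "W \<in> rapid" and m [measurable]: "c \<in> borel_measurable borel" and k: "0 \<le> k"
    and c: "\<And>p. p \<in> shearlet_group \<Longrightarrow> \<bar>c p\<bar> \<le> k * shearlet_weight p ^ n"
  shows "(\<lambda>p. of_real (c p) * W p) \<in> rapid"
proof -
  note [measurable] = rapid_measurable[OF W]
  have "\<exists>A. decay_bound N (\<lambda>p. of_real (c p) * W p) A" for N
    using decay_bound_mult[OF W _ k c] rapid_decay[OF W] by blast
  moreover have "(\<lambda>p. of_real (c p) * W p) \<in> borel_measurable borel" by measurable
  ultimately show ?thesis using rapid_zero[OF W] unfolding rapid_def by simp
qed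

abbreviation scaled_weight :: "2 \<Rightarrow> real ^ 2 \<Rightarrow> ((real ^ 2) \<times> real \<times> real \<Rightarrow> complex) \<Rightarrow>
    (real ^ 2) \<times> real \<times> real \<Rightarrow> complex" where
  "scaled_weight i v W \<equiv> (\<lambda>p. of_real (shearlet_factor i v p) * W p)"

lemma rapid_scaled_weight: "W \<in> rapid \<Longrightarrow> scaled_weight i v W \<in> rapid"
  by (rule rapid_mult[where n = 1 and k = "2 * norm v"]) (auto simp: shearlet_factor_le)

lemma decay_bound_scaled_weight:
  assumes "W \<in> rapid" "decay_bound (Suc N) W A"
  shows "decay_bound N (scaled_weight i v W) (2 * norm v * A)"
  by (rule decay_bound_mult[where n = 1]) (use assms in \<open>auto simp: shearlet_factor_le\<close>)

text \<open>The derivative of \<phi> composed with \<open>M\<close> is its derivative along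
  \<open>M v\<close>, whose components are the factors in \<open>scaled_weight\<close>. Taylor's
  formula bounds the remainder of the integrand by a constant times the square of
  \<open>norm (M h)\<close>; its growth is quadratic in the weight and is absorbed by
  \<open>W\<close>, so the integrated remainder is quadratic in \<open>h\<close>.\<close>

lemma superposition_has_derivative:
  assumes W: "W \<in> rapid" and \<phi>: "\<phi> \<in> schwartz_space"
  shows "(superposition W \<phi> has_derivative
     (\<lambda>v. superposition (scaled_weight 1 v W) (dir_deriv (axis 1 1) \<phi>) x
        + superposition (scaled_weight 2 v W) (dir_deriv (axis 2 1) \<phi>) x)) (at x)"
    (is "(_ has_derivative ?L) _")
proof -
  let ?\<phi>1 = "dir_deriv (axis 1 1) \<phi>" let ?\<phi>2 = "dir_deriv (axis 2 1) \<phi>"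
  have s1: "?\<phi>1 \<in> schwartz_space" and s2: "?\<phi>2 \<in> schwartz_space"
    using schwartz_dir_deriv[OF \<phi>] by auto
  note int1 = superposition_integrable_schwartz[OF rapid_scaled_weight[OF W] s1]
  note int2 = superposition_integrable_schwartz[OF rapid_scaled_weight[OF W] s2]
  note int = superposition_integrable_schwartz[OF W \<phi>]
  note D = dir_deriv_sum_basis[OF schwartz_smooth[OF \<phi>], of "shearlet_coord s a v" for s a v]
  \<comment> \<open>Merged into one integral, \<open>?L v\<close> can be compared with the Taylor
    remainder and is visibly linear in \<open>v\<close>. The form with two terms is kept in the
    statement because it consists of superpositions, which can be differentiated again.\<close>
  have L: "?L v = (LINT p|lborel. W p * dir_deriv (shearlet_coord (fst (snd p)) (snd (snd p)) v) \<phi> (shearlet_arg x p))" for v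
    unfolding superposition_def
    by (subst Bochner_Integration.integral_add[symmetric, OF int1 int2])
      (simp add: D shearlet_factor_def algebra_simps)
  have intL: "integrable lborel (\<lambda>p. W p * dir_deriv (shearlet_coord (fst (snd p)) (snd (snd p)) v) \<phi> (shearlet_arg x p))" for v
    using Bochner_Integration.integrable_add[OF int1[of 1 v x] int2[of 2 v x]]
    by (simp add: D shearlet_factor_def algebra_simps)
  obtain K where K: "0 \<le> K" "\<And>x u v. norm (dir_deriv u (dir_deriv v \<phi>) x) \<le> K * norm u * norm v"
    using schwartz_second_dir_deriv_bounded[OF \<phi>] by metis
  \<comment> \<open>One order for the factor in \<open>scaled_weight\<close> and six for
    integrability; this bounds \<open>?L\<close>.\<close>
  obtain A where A: "decay_bound (Suc (2 * 0 + 6)) W A" using rapid_decay[OF W] by blast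
  \<comment> \<open>Two orders for the square of \<open>M h\<close> and six for integrability; this
    bounds the remainder.\<close>
  obtain A2 where A2: "decay_bound 8 W A2" using rapid_decay[OF W] by blast
  obtain B1 where B1: "0 \<le> B1" "\<And>x. jbracket x ^ 0 * norm (?\<phi>1 x) \<le> B1"
    using schwartz_bounded[OF s1] by metis
  obtain B2 where B2: "0 \<le> B2" "\<And>x. jbracket x ^ 0 * norm (?\<phi>2 x) \<le> B2"
    using schwartz_bounded[OF s2] by metis
  have dl: "linear (\<lambda>w. dir_deriv w \<phi> y)" for y
    using smooth_has_derivative[OF schwartz_smooth[OF \<phi>]] has_derivative_linear by blast
  have bl: "bounded_linear ?L"
  proof (rule bounded_linear_intro)
    fix u v
    show "?L (u + v) = ?L u + ?L v"
      unfolding L by (subst Bochner_Integration.integral_add[symmetric, OF intL intL])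
        (simp add: linear_add[OF linear_shearlet_coord] linear_add[OF dl] algebra_simps)
  next
    fix r :: real and v
    show "?L (r *\<^sub>R v) = r *\<^sub>R ?L v"
      unfolding L by (subst Bochner_Integration.integral_scaleR_right[symmetric])
        (simp add: linear_scale[OF linear_shearlet_coord] linear_scale[OF dl])
  next
    fix v
    have "norm (superposition (scaled_weight 1 v W) ?\<phi>1 x) \<le> 2 * norm v * A * B1 * jbracket_integral"
      using superposition_bound[OF rapid_scaled_weight[OF W] decay_bound_scaled_weight[OF W A] B1(2)]
      by simp
    moreover have "norm (superposition (scaled_weight 2 v W) ?\<phi>2 x) \<le> 2 * norm v * A * B2 * jbracket_integral"
      using superposition_bound[OF rapid_scaled_weight[OF W] decay_bound_scaled_weight[OF W A] B2(2)]
      by simp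
    ultimately show "norm (?L v) \<le> norm v * (2 * A * (B1 + B2) * jbracket_integral)"
      using norm_triangle_ineq[of "superposition (scaled_weight 1 v W) ?\<phi>1 x" "superposition (scaled_weight 2 v W) ?\<phi>2 x"]
      by (simp add: algebra_simps)
  qed
  \<comment> \<open>The 16 is the square of the constant 4 in
    \<open>norm_shearlet_coord_le\<close>.\<close>
  define C where "C = 16 * K * A2 * jbracket_integral"
  have C: "norm (superposition W \<phi> (x + h) - superposition W \<phi> x - ?L h) \<le> C * (norm h)\<^sup>2" for h
  proof -
    let ?f = "\<lambda>p. W p * \<phi> (shearlet_arg (x + h) p) - W p * \<phi> (shearlet_arg x p)
      - W p * dir_deriv (shearlet_coord (fst (snd p)) (snd (snd p)) h) \<phi> (shearlet_arg x p)"
    have "superposition W \<phi> (x + h) - superposition W \<phi> x - ?L h = (LINT p|lborel. ?f p)"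
      unfolding L unfolding superposition_def
      by (simp add: int intL)
    also have "norm \<dots> \<le> (16 * K * A2 * (norm h)\<^sup>2) * jbracket_integral"
    proof (rule norm_integral_le_jbracket_integral)
      fix p :: "(real ^ 2) \<times> real \<times> real"
      show "norm (?f p) \<le> 16 * K * A2 * (norm h)\<^sup>2 / jbracket p ^ 6"
      proof (cases "p \<in> shearlet_group")
        case False
        then show ?thesis using rapid_zero[OF W False] K decay_bound_nonneg[OF A2] jbracket_pos[of p]
          by (simp add: less_imp_le)
      next
        case True
        then obtain b s a where p: "p = (b, s, a)" and a: "a \<noteq> 0" by (auto simp: shearlet_group_def)
        let ?q = "shearlet_weight p" let ?w = "shearlet_coord s a h"
        have arg: "shearlet_arg (x + h) p = shearlet_arg x p + ?w"
          using linear_add[OF linear_shearlet_coord, of s a "x - b" h]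
          by (simp add: shearlet_arg_def p algebra_simps)
        have "?f p = W p * (\<phi> (shearlet_arg x p + ?w) - \<phi> (shearlet_arg x p) - dir_deriv ?w \<phi> (shearlet_arg x p))"
          unfolding arg by (simp add: p algebra_simps)
        then have "norm (?f p) = norm (W p) * norm (\<phi> (shearlet_arg x p + ?w) - \<phi> (shearlet_arg x p) - dir_deriv ?w \<phi> (shearlet_arg x p))"
          by (simp add: norm_mult)
        also have "\<dots> \<le> norm (W p) * (K * (norm ?w)\<^sup>2)"
          by (intro mult_left_mono smooth_taylor schwartz_smooth \<phi> K) auto
        also have "\<dots> \<le> norm (W p) * (K * (4 * norm h * ?q)\<^sup>2)"
          using norm_shearlet_coord_le[OF a, of s h b] K unfolding p
          by (intro mult_left_mono power_mono) auto
        also have "\<dots> = 16 * K * (norm h)\<^sup>2 * (?q ^ 2 * norm (W p))"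
          by (simp add: power_mult_distrib mult_ac)
        also have "\<dots> \<le> 16 * K * (norm h)\<^sup>2 * (A2 / jbracket p ^ 6)"
        proof (intro mult_left_mono)
          have "jbracket p ^ 6 * (?q ^ 2 * norm (W p)) \<le> ?q ^ 6 * (?q ^ 2 * norm (W p))"
            using shearlet_weight_ge(1)[OF a, of b s] jbracket_pos[of p] unfolding p
            by (intro mult_right_mono power_mono) auto
          also have "\<dots> = ?q ^ 8 * norm (W p)" by (simp flip: mult.assoc power_add)
          also have "\<dots> \<le> A2" using A2 unfolding decay_bound_def by blast
          finally show "?q ^ 2 * norm (W p) \<le> A2 / jbracket p ^ 6"
            using jbracket_pos[of p] by (simp add: field_simps)
        qed (use K in auto)
        finally show ?thesis by (simp add: mult_ac)
      qed
    qed
    finally show ?thesis by (simp add: C_def mult_ac)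
  qed
  show ?thesis
    unfolding has_derivative_at
  proof (intro conjI bl)
    show "(\<lambda>h. norm (superposition W \<phi> (x + h) - superposition W \<phi> x - ?L h) / norm h) \<midarrow>0\<rightarrow> 0"
    proof (rule Lim_null_comparison)
      show "((\<lambda>h::real^2. C * norm h) \<longlongrightarrow> 0) (at 0)"
        by (auto intro!: tendsto_eq_intros)
      show "\<forall>\<^sub>F h in at 0. norm (norm (superposition W \<phi> (x + h) - superposition W \<phi> x - ?L h) / norm h) \<le> C * norm h"
        unfolding eventually_at_filter
      proof (intro always_eventually allI impI)
        fix h :: "real ^ 2" assume "h \<noteq> 0"
        then show "norm (norm (superposition W \<phi> (x + h) - superposition W \<phi> x - ?L h) / norm h) \<le> C * norm h"
          using C[of h] by (simp add: divide_simps power2_eq_square mult_ac)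
      qed
    qed
  qed
qed

text \<open>The coefficients 1 are written out so that the right side matches
  \<open>Ck_lincomb\<close>.\<close>

lemma dir_deriv_superposition:
  assumes "W \<in> rapid" "\<phi> \<in> schwartz_space"
  shows "dir_deriv v (superposition W \<phi>) = (\<lambda>x.
      1 * superposition (scaled_weight 1 v W) (dir_deriv (axis 1 1) \<phi>) x
    + 1 * superposition (scaled_weight 2 v W) (dir_deriv (axis 2 1) \<phi>) x)"
  using dir_deriv_eq_has_derivative[OF superposition_has_derivative[OF assms]] by auto

lemma superposition_smooth:
  assumes "W \<in> rapid" "\<phi> \<in> schwartz_space"
  shows "smooth_on UNIV (superposition W \<phi>)"
proof -
  have "Ck_on k UNIV (superposition W \<phi>)" for k
    using assms
  proof (induction k arbitrary: W \<phi>)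
    case 0
    show ?case
      using superposition_has_derivative[OF 0]
      by (auto intro!: continuous_at_imp_continuous_on has_derivative_continuous)
  next
    case (Suc k)
    have "Ck_on k UNIV (superposition (scaled_weight i v W) (dir_deriv e \<phi>))"
      if "e = axis 1 1 \<or> e = axis 2 1" for i v e
      by (intro Suc.IH rapid_scaled_weight schwartz_dir_deriv Suc.prems that)
    then have "Ck_on k UNIV (dir_deriv v (superposition W \<phi>))" for v
      unfolding dir_deriv_superposition[OF Suc.prems] by (intro Ck_lincomb) auto
    moreover have "superposition W \<phi> differentiable at x" for x
      using superposition_has_derivative[OF Suc.prems] by (auto simp: differentiable_def)
    ultimately show ?case unfolding Ck_Suc_UNIV by blast
  qed
  then show ?thesis by (simp add: smooth_on_def)
qed

subsection \<open>Schwartz estimates for superpositions\<close>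

lemma fold_dir_deriv_lincomb:
  assumes "smooth_on UNIV f" "smooth_on UNIV g"
  shows "fold dir_deriv vs (\<lambda>x. c * f x + d * g x) =
    (\<lambda>x. c * fold dir_deriv vs f x + d * fold dir_deriv vs g x)"
  using assms
proof (induction vs arbitrary: f g)
  case (Cons v vs)
  have "dir_deriv v (\<lambda>x. c * f x + d * g x) = (\<lambda>x. c * dir_deriv v f x + d * dir_deriv v g x)"
    using Cons.prems by (simp add: fun_eq_iff dir_deriv_lincomb smooth_differentiable)
  then show ?case
    using Cons.IH[OF smooth_dir_deriv[OF Cons.prems(1)] smooth_dir_deriv[OF Cons.prems(2)]] by simp
qed simp

lemma schwartz_norm_mono:
  assumes "\<mu> \<le> \<nu>"
  shows "schwartz_norm \<mu> f \<le> schwartz_norm \<nu> f"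
  unfolding schwartz_norm_def
proof (rule SUP_mono, clarify)
  fix x :: "real ^ 2" and m :: "nat ^ 2" assume "(\<Sum>i\<in>UNIV. m $ i) \<le> \<mu>"
  then show "\<exists>q\<in>UNIV \<times> {m. (\<Sum>i\<in>UNIV. m $ i) \<le> \<nu>}.
      ennreal (jbracket x ^ \<mu> * norm (partial_deriv m f x))
      \<le> (case q of (x, m) \<Rightarrow> ennreal (jbracket x ^ \<nu> * norm (partial_deriv m f x)))"
    using assms by (intro bexI[of _ "(x, m)"])
      (auto intro!: ennreal_leI mult_right_mono power_increasing jbracket_ge_1)
qed

text \<open>A list of directions makes the innermost derivative, the one that meets the
  superposition, the head for the induction. Each derivative gives 4: one factor 2 because a
  superposition splits into two, another from the bound on the entries of \<open>M v\<close>. It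
  also costs one order of decay of \<open>W\<close> and one order in the norm of \<phi>.\<close>

lemma fold_dir_deriv_superposition_bound:
  assumes "W \<in> rapid" "\<phi> \<in> schwartz_space" "\<And>v. v \<in> set vs \<Longrightarrow> norm v \<le> 1"
    and "decay_bound (length vs + (2 * \<nu> + 6)) W A"
    and "schwartz_norm (\<nu> + length vs) \<phi> \<le> ennreal B" and B: "0 \<le> B"
  shows "jbracket x ^ \<nu> * norm (fold dir_deriv vs (superposition W \<phi>) x)
    \<le> 4 ^ length vs * (16 ^ \<nu> * A * B * jbracket_integral)"
  using assms(1-5)
proof (induction vs arbitrary: W \<phi> A)
  case Nil
  have "jbracket z ^ \<nu> * norm (\<phi> z) \<le> B" for z
    using funpow_dir_deriv_le_schwartz_norm[of \<nu> \<phi> B 0 0 z] Nil B by simp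
  then show ?case using superposition_bound[of W \<nu> A \<phi> B x] Nil by simp
next
  case (Cons v vs)
  let ?S = "\<lambda>i. superposition (scaled_weight i v W) (dir_deriv (axis i 1) \<phi>)"
  have e: "axis i (1::real) = axis 1 1 \<or> axis i (1::real) = axis 2 1" for i :: 2
    using exhaust_2[of i] by auto
  note sd = schwartz_dir_deriv[OF Cons.prems(2) e]
  have bd: "jbracket x ^ \<nu> * norm (fold dir_deriv vs (?S i) x)
      \<le> 4 ^ length vs * (16 ^ \<nu> * (2 * A) * B * jbracket_integral)" for i
  proof (rule Cons.IH)
    show "scaled_weight i v W \<in> rapid" by (rule rapid_scaled_weight[OF Cons.prems(1)])
    show "dir_deriv (axis i 1) \<phi> \<in> schwartz_space" by (rule sd)
    show "norm u \<le> 1" if "u \<in> set vs" for u using Cons.prems(3) that by simp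
    have d: "decay_bound (length vs + (2 * \<nu> + 6)) (scaled_weight i v W) (2 * norm v * A)"
      by (rule decay_bound_scaled_weight[OF Cons.prems(1)]) (use Cons.prems(4) in simp)
    have "norm v * A \<le> 1 * A"
      using Cons.prems(3)[of v] decay_bound_nonneg[OF Cons.prems(4)] by (intro mult_right_mono) auto
    then show "decay_bound (length vs + (2 * \<nu> + 6)) (scaled_weight i v W) (2 * A)"
      using order_trans[OF d[unfolded decay_bound_def, rule_format], of "2 * A"]
      unfolding decay_bound_def by simp
    have "schwartz_norm (\<nu> + length vs) (dir_deriv (axis i 1) \<phi>) \<le> schwartz_norm (Suc (\<nu> + length vs)) \<phi>"
      by (rule schwartz_norm_dir_deriv_le[OF schwartz_smooth[OF Cons.prems(2)] e])
    then show "schwartz_norm (\<nu> + length vs) (dir_deriv (axis i 1) \<phi>) \<le> ennreal B"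
      using Cons.prems(5) by simp
  qed
  have sm: "smooth_on UNIV (?S i)" for i
    by (intro superposition_smooth rapid_scaled_weight Cons.prems(1) sd)
  have "fold dir_deriv (v # vs) (superposition W \<phi>) x = fold dir_deriv vs (?S 1) x + fold dir_deriv vs (?S 2) x"
    by (simp add: dir_deriv_superposition[OF Cons.prems(1,2)] fold_dir_deriv_lincomb[OF sm sm, of _ 1 _ 1, simplified])
  then have "jbracket x ^ \<nu> * norm (fold dir_deriv (v # vs) (superposition W \<phi>) x)
      \<le> jbracket x ^ \<nu> * (norm (fold dir_deriv vs (?S 1) x) + norm (fold dir_deriv vs (?S 2) x))"
    using jbracket_pos[of x] by (auto intro!: mult_left_mono norm_triangle_ineq)
  also have "\<dots> \<le> 4 ^ length (v # vs) * (16 ^ \<nu> * A * B * jbracket_integral)"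
    using bd[of 1] bd[of 2] by (simp add: algebra_simps)
  finally show ?case .
qed

text \<open>The previous bound with at most \<nu> directions: decay of order \<nu> for derivatives,
  \<open>2 * \<nu>\<close> for the weight, 6 for integrability, and 64 as the product of 4 and
  16.\<close>

lemma schwartz_norm_superposition_le:
  assumes W: "W \<in> rapid" and \<phi>: "\<phi> \<in> schwartz_space"
    and A: "decay_bound (3 * \<nu> + 6) W A"
    and B: "schwartz_norm (2 * \<nu>) \<phi> \<le> ennreal B" "0 \<le> B"
  shows "schwartz_norm \<nu> (superposition W \<phi>) \<le> ennreal (64 ^ \<nu> * jbracket_integral * A * B)"
proof (rule schwartz_norm_leI)
  fix x j k assume jk: "j + k \<le> \<nu>"
  \<comment> \<open>\<open>fold\<close> applies the head first, so the directions of the inner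
    derivatives, along the second axis, come first.\<close>
  let ?vs = "replicate k (axis 2 1) @ replicate j (axis 1 1) :: (real ^ 2) list"
  have len: "length ?vs = j + k" by simp
  have "(dir_deriv (axis 1 1) ^^ j) ((dir_deriv (axis 2 1) ^^ k) (superposition W \<phi>)) =
     fold dir_deriv ?vs (superposition W \<phi>)"
    by (simp add: fold_replicate)
  then have "jbracket x ^ \<nu> * norm ((dir_deriv (axis 1 1) ^^ j) ((dir_deriv (axis 2 1) ^^ k) (superposition W \<phi>)) x)
      = jbracket x ^ \<nu> * norm (fold dir_deriv ?vs (superposition W \<phi>) x)" by simp
  also have "\<dots> \<le> 4 ^ (j + k) * (16 ^ \<nu> * A * B * jbracket_integral)"
    unfolding len[symmetric]
  proof (rule fold_dir_deriv_superposition_bound[OF W \<phi> _ _ _ B(2)])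
    show "decay_bound (length ?vs + (2 * \<nu> + 6)) W A"
      by (rule decay_bound_mono[OF W A]) (use jk in simp)
    show "schwartz_norm (\<nu> + length ?vs) \<phi> \<le> ennreal B"
      using schwartz_norm_mono[of "\<nu> + length ?vs" "2 * \<nu>" \<phi>] jk B(1) by simp
  qed auto
  also have "\<dots> \<le> 4 ^ \<nu> * (16 ^ \<nu> * A * B * jbracket_integral)"
    using jk B(2) decay_bound_nonneg[OF A] jbracket_integral_nonneg
    by (intro mult_right_mono power_increasing) auto
  also have "\<dots> = 64 ^ \<nu> * jbracket_integral * A * B"
    by (simp add: mult_ac flip: power_mult_distrib)
  finally show "jbracket x ^ \<nu> * norm ((dir_deriv (axis 1 1) ^^ j) ((dir_deriv (axis 2 1) ^^ k) (superposition W \<phi>)) x)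
    \<le> 64 ^ \<nu> * jbracket_integral * A * B" .
qed

lemma superposition_schwartz:
  assumes "W \<in> rapid" "\<phi> \<in> schwartz_space"
  shows "superposition W \<phi> \<in> schwartz_space"
proof -
  have "schwartz_norm \<nu> (superposition W \<phi>) < \<infinity>" for \<nu>
  proof -
    obtain A where A: "decay_bound (3 * \<nu> + 6) W A" using rapid_decay[OF assms(1)] by blast
    obtain B where B: "0 \<le> B" "schwartz_norm (2 * \<nu>) \<phi> = ennreal B"
      using schwartz_norm_boundE schwartz_norm_finite[OF assms(2)] by metis
    have "schwartz_norm \<nu> (superposition W \<phi>) \<le> ennreal (64 ^ \<nu> * jbracket_integral * A * B)"
      by (rule schwartz_norm_superposition_le[OF assms A]) (use B in auto)
    then show ?thesis by (rule le_less_trans) simp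
  qed
  then show ?thesis unfolding schwartz_space_def using superposition_smooth[OF assms] by simp
qed

subsection \<open>Vanishing moments\<close>

lemma abs_monomial_le_jbracket:
  fixes x :: "real ^ 2"
  shows "\<bar>x $ 1 ^ j * x $ 2 ^ k\<bar> \<le> jbracket x ^ (j + k)"
proof -
  have "\<bar>x $ i\<bar> \<le> jbracket x" for i
    using component_le_norm_cart[of x i] norm_le_jbracket[of x] by linarith
  then show ?thesis unfolding abs_mult power_abs power_add
    using jbracket_pos[of x] by (intro mult_mono power_mono) auto
qed

lemma lizorkin_schwartz: "\<psi> \<in> lizorkin_space \<Longrightarrow> \<psi> \<in> schwartz_space"
  unfolding lizorkin_space_def by simp

lemma schwartz_monomial_integrable:
  assumes \<phi>: "\<phi> \<in> schwartz_space"
  shows "integrable lborel (\<lambda>x. complex_of_real (x $ 1 ^ j * x $ 2 ^ k) * \<phi> x)"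
proof -
  note [measurable] = schwartz_measurable[OF \<phi>]
  obtain B where B: "\<And>x. jbracket x ^ (j + k + 4) * norm (\<phi> x) \<le> B"
    using schwartz_bounded[OF \<phi>] by metis
  have le: "norm (complex_of_real (x $ 1 ^ j * x $ 2 ^ k) * \<phi> x) \<le> B * (1 / jbracket x ^ 4)" for x
  proof -
    have "jbracket x ^ 4 * norm (complex_of_real (x $ 1 ^ j * x $ 2 ^ k) * \<phi> x)
        \<le> jbracket x ^ 4 * (jbracket x ^ (j + k) * norm (\<phi> x))"
      unfolding norm_mult norm_of_real using abs_monomial_le_jbracket[of x j k] jbracket_pos[of x]
      by (intro mult_left_mono mult_right_mono) auto
    also have "\<dots> \<le> B" using B[of x] by (simp add: power_add mult_ac)
    finally show ?thesis using jbracket_pos[of x] by (simp add: field_simps)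
  qed
  show ?thesis
  proof (rule Bochner_Integration.integrable_bound)
    show "integrable lborel (\<lambda>x :: real ^ 2. B * (1 / jbracket x ^ 4))"
      by (intro integrable_mult_right integrable_inverse_jbracket_power) simp
    show "AE x in lborel. norm (complex_of_real (x $ 1 ^ j * x $ 2 ^ k) * \<phi> x) \<le> norm (B * (1 / jbracket x ^ 4))"
      using le by (intro AE_I2) (simp only: real_norm_def, rule order_trans[OF _ abs_ge_self], simp)
  qed measurable
qed

lemma lizorkin_iff_moments:
  "\<psi> \<in> lizorkin_space \<longleftrightarrow> \<psi> \<in> schwartz_space \<and>
    (\<forall>j k. (LINT x|lborel. complex_of_real (x $ 1 ^ j * x $ 2 ^ k) * \<psi> x) = 0)"
proof -
  have "(\<forall>m :: nat ^ 2. P (m $ 1) (m $ 2)) \<longleftrightarrow> (\<forall>j k. P j k)" for P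
    by (metis vector_2)
  from this[of "\<lambda>j k. (LINT x|lborel. complex_of_real (x $ 1 ^ j * x $ 2 ^ k) * \<psi> x) = 0"]
  show ?thesis unfolding lizorkin_space_def by (simp add: UNIV_2)
qed

text \<open>Expanding one affine factor at a time multiplies the monomial by \<open>z $ 1\<close> or
  \<open>z $ 2\<close>; this is why a free monomial is carried along and generalized. The second
  factor has no \<open>z $ 1\<close> because the inverse of \<open>M\<close> is upper triangular.
  \<open>has_bochner_integral\<close> carries the integrability needed to add the terms.\<close>

lemma lizorkin_affine_moments:
  assumes \<psi>: "\<psi> \<in> lizorkin_space"
  shows "has_bochner_integral lborel (\<lambda>z. complex_of_real (z $ 1 ^ j * z $ 2 ^ k *
    (c1 + \<alpha> * z $ 1 + \<beta> * z $ 2) ^ m * (c2 + \<gamma> * z $ 2) ^ n) * \<psi> z) 0"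
proof (induction m arbitrary: j k)
  case 0
  show ?case
  proof (induction n arbitrary: k)
    case 0
    show ?case using \<psi> schwartz_monomial_integrable[OF lizorkin_schwartz[OF \<psi>], of j k]
      unfolding lizorkin_iff_moments by (simp add: has_bochner_integral_iff)
  next
    case (Suc n)
    have "has_bochner_integral lborel (\<lambda>z.
        of_real c2 * (complex_of_real (z $ 1 ^ j * z $ 2 ^ k *
          (c1 + \<alpha> * z $ 1 + \<beta> * z $ 2) ^ 0 * (c2 + \<gamma> * z $ 2) ^ n) * \<psi> z)
      + of_real \<gamma> * (complex_of_real (z $ 1 ^ j * z $ 2 ^ Suc k *
          (c1 + \<alpha> * z $ 1 + \<beta> * z $ 2) ^ 0 * (c2 + \<gamma> * z $ 2) ^ n) * \<psi> z))
      (of_real c2 * 0 + of_real \<gamma> * 0)"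
      by (intro has_bochner_integral_add has_bochner_integral_mult_right Suc.IH)
    then show ?case by (simp add: algebra_simps)
  qed
next
  case (Suc m)
  have "has_bochner_integral lborel (\<lambda>z.
      of_real c1 * (complex_of_real (z $ 1 ^ j * z $ 2 ^ k *
        (c1 + \<alpha> * z $ 1 + \<beta> * z $ 2) ^ m * (c2 + \<gamma> * z $ 2) ^ n) * \<psi> z)
    + of_real \<alpha> * (complex_of_real (z $ 1 ^ Suc j * z $ 2 ^ k *
        (c1 + \<alpha> * z $ 1 + \<beta> * z $ 2) ^ m * (c2 + \<gamma> * z $ 2) ^ n) * \<psi> z)
    + of_real \<beta> * (complex_of_real (z $ 1 ^ j * z $ 2 ^ Suc k *
        (c1 + \<alpha> * z $ 1 + \<beta> * z $ 2) ^ m * (c2 + \<gamma> * z $ 2) ^ n) * \<psi> z))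
    (of_real c1 * 0 + of_real \<alpha> * 0 + of_real \<beta> * 0)"
    by (intro has_bochner_integral_add has_bochner_integral_mult_right Suc.IH)
  then show ?case by (simp add: algebra_simps)
qed

lemma lborel_integral_translate:
  fixes f :: "'a::euclidean_space \<Rightarrow> complex"
  assumes [measurable]: "f \<in> borel_measurable borel"
  shows "(LINT x|lborel. f x) = (LINT x|lborel. f (c + x))"
proof -
  have "(LINT x|lborel. f x) = (LINT x|distr lborel borel ((+) c). f x)"
    by (simp only: lborel_distr_plus)
  then show ?thesis by (simp add: integral_distr)
qed

lemma lizorkin_sheared_moments:
  assumes \<psi>: "\<psi> \<in> lizorkin_space" and a: "a \<noteq> 0"
  shows "(LINT x|lborel. complex_of_real (x $ 1 ^ j * x $ 2 ^ k) * \<psi> (shearlet_coord s a (x - b))) = 0"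
proof -
  note [measurable] = schwartz_measurable[OF lizorkin_schwartz[OF \<psi>]]
  let ?h = "shearlet_coord s a" let ?g = "a / sqrt \<bar>a\<bar>"
  have inj: "inj ?h"
  proof (rule injI)
    fix x y assume "?h x = ?h y"
    then have "norm (x - y) \<le> 0"
      using norm_le_shearlet_coord[OF a, of "x - y" b s] linear_diff[OF linear_shearlet_coord, of s a x y] by simp
    then show "x = y" by simp
  qed
  have [measurable]: "?h \<in> borel_measurable borel"
    unfolding shearlet_coord_def[abs_def] by measurable
  \<comment> \<open>The monomial in \<open>x = b + y\<close> expressed in the coordinates
    \<open>z = M y\<close>, by the inverse relations
    \<open>y $ 1 = a * z $ 1 - s * ?g * z $ 2\<close> and \<open>y $ 2 = ?g * z $ 2\<close>.\<close>
  define f where "f z = complex_of_real ((b $ 1 + a * z $ 1 + (- s * ?g) * z $ 2) ^ j * (b $ 2 + ?g * z $ 2) ^ k) * \<psi> z" for z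
  have "(LINT x|lborel. complex_of_real (x $ 1 ^ j * x $ 2 ^ k) * \<psi> (?h (x - b))) =
      (LINT y|lborel. complex_of_real ((b + y) $ 1 ^ j * (b + y) $ 2 ^ k) * \<psi> (?h y))"
    by (subst lborel_integral_translate[where c = b]) (auto, measurable)
  also have "\<dots> = (LINT y|lborel. f (?h y))"
  proof (intro Bochner_Integration.integral_cong refl)
    fix y :: "real ^ 2"
    have 1: "b $ 1 + a * ?h y $ 1 + (- s * ?g) * ?h y $ 2 = (b + y) $ 1" using a by simp
    have 2: "b $ 2 + ?g * ?h y $ 2 = (b + y) $ 2" using a by simp
    show "complex_of_real ((b + y) $ 1 ^ j * (b + y) $ 2 ^ k) * \<psi> (?h y) = f (?h y)"
      unfolding f_def 1 2 ..
  qed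
  also have "\<dots> = (1 / \<bar>det (matrix ?h)\<bar>) *\<^sub>R (LINT z|lborel. f z)"
    by (rule integral_linear_lborel[OF linear_shearlet_coord inj]) (unfold f_def[abs_def], measurable)
  also have "(LINT z|lborel. f z) = 0"
    using lizorkin_affine_moments[OF \<psi>, of 0 0 "b $ 1" a "- s * ?g" j "b $ 2" ?g k]
    unfolding f_def by (simp add: has_bochner_integral_iff)
  finally show ?thesis by simp
qed

lemma superposition_lizorkin:
  assumes W: "W \<in> rapid" and \<psi>: "\<psi> \<in> lizorkin_space"
  shows "superposition W \<psi> \<in> lizorkin_space"
proof -
  note sch = lizorkin_schwartz[OF \<psi>]
  note [measurable] = schwartz_measurable[OF sch] rapid_measurable[OF W]
  have "(LINT x|lborel. complex_of_real (x $ 1 ^ j * x $ 2 ^ k) * superposition W \<psi> x) = 0" for j k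
  proof -
    let ?P = "\<lambda>x :: real ^ 2. complex_of_real (x $ 1 ^ j * x $ 2 ^ k)"
    let ?f = "\<lambda>x p. ?P x * (W p * \<psi> (shearlet_arg x p))"
    \<comment> \<open>Weight \<open>j + k\<close> absorbs the monomial. The extra 8 is the dimension
      6 of the joint space of \<open>x\<close> and \<open>p\<close> plus 2, for integrability
      there.\<close>
    define \<nu> where "\<nu> = j + k + 8"
    obtain A where A: "decay_bound (2 * \<nu> + 8) W A" using rapid_decay[OF W] by blast
    obtain B where B: "\<And>x. jbracket x ^ \<nu> * norm (\<psi> x) \<le> B"
      using schwartz_bounded[OF sch] by metis
    define C where "C = 16 ^ \<nu> * A * B"
    \<comment> \<open>Fubini needs one dominating function on the product space; decay of order 8 in
      \<open>x\<close> and in \<open>p\<close> separately provides it.\<close>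
    have le: "norm (?f x p) \<le> C * (1 / jbracket (x, p) ^ 8)" for x p
    proof -
      have C: "jbracket x ^ \<nu> * norm (W p * \<psi> (shearlet_arg x p)) \<le> C / jbracket p ^ 8"
        unfolding C_def by (rule superposition_kernel_bound[OF W A B])
      have "jbracket (x, p) ^ 8 * norm (?f x p)
          \<le> (jbracket x * jbracket p) ^ 8 * (jbracket x ^ (j + k) * norm (W p * \<psi> (shearlet_arg x p)))"
        unfolding norm_mult[of "?P x"] norm_of_real
        using abs_monomial_le_jbracket[of x j k] jbracket_pos[of x] jbracket_pos[of p] jbracket_pos[of "(x, p)"]
        by (intro mult_mono power_mono jbracket_Pair_le) auto
      also have "\<dots> = jbracket p ^ 8 * (jbracket x ^ \<nu> * norm (W p * \<psi> (shearlet_arg x p)))"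
        by (simp add: \<nu>_def power_add power_mult_distrib mult_ac)
      also have "\<dots> \<le> jbracket p ^ 8 * (C / jbracket p ^ 8)"
        using C jbracket_pos[of p] by (intro mult_left_mono) auto
      also have "\<dots> = C" using jbracket_pos[of p] by simp
      finally show ?thesis using jbracket_pos[of "(x, p)"] by (simp add: field_simps)
    qed
    have "integrable lborel (\<lambda>z. ?f (fst z) (snd z))"
    proof (rule Bochner_Integration.integrable_bound)
      show "integrable lborel (\<lambda>z :: (real ^ 2) \<times> (real ^ 2) \<times> real \<times> real. C * (1 / jbracket z ^ 8))"
        by (intro integrable_mult_right integrable_inverse_jbracket_power) simp
      show "AE z in lborel. norm (?f (fst z) (snd z)) \<le> norm (C * (1 / jbracket z ^ 8))"
        using le by (intro AE_I2) (simp only: real_norm_def, rule order_trans[OF _ abs_ge_self], metis prod.collapse)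
      have [measurable]: "(\<lambda>z. shearlet_arg (fst z) (snd z)) \<in> borel \<Otimes>\<^sub>M borel \<rightarrow>\<^sub>M borel"
        unfolding borel_prod by measurable
      have "(\<lambda>z. ?f (fst z) (snd z)) \<in> borel_measurable (borel \<Otimes>\<^sub>M borel)"
        by measurable
      then show "(\<lambda>z. ?f (fst z) (snd z)) \<in> borel_measurable lborel"
        unfolding borel_prod by simp
    qed
    then have int: "integrable (lborel \<Otimes>\<^sub>M lborel) (\<lambda>(x, p). ?f x p)"
      unfolding lborel_prod by (simp add: case_prod_beta')
    have "(LINT x|lborel. ?P x * superposition W \<psi> x) = (LINT x|lborel. LINT p|lborel. ?f x p)"
      unfolding superposition_def by (simp only: integral_mult_right_zero)
    also have "\<dots> = (LINT p|lborel. LINT x|lborel. ?f x p)"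
      by (rule lborel_pair.Fubini_integral[OF int, symmetric])
    also have "\<dots> = (LINT p|(lborel :: ((real ^ 2) \<times> real \<times> real) measure). 0)"
    proof (intro Bochner_Integration.integral_cong refl)
      fix p :: "(real ^ 2) \<times> real \<times> real"
      show "(LINT x|lborel. ?f x p) = 0"
      proof (cases "p \<in> shearlet_group")
        case True
        then obtain b s a where p: "p = (b, s, a)" and a: "a \<noteq> 0" by (auto simp: shearlet_group_def)
        have "(LINT x|lborel. ?f x p) = (LINT x|lborel. W p * (?P x * \<psi> (shearlet_coord s a (x - b))))"
          by (simp add: p shearlet_arg_def mult_ac)
        also have "\<dots> = W p * (LINT x|lborel. ?P x * \<psi> (shearlet_coord s a (x - b)))"
          by (simp only: integral_mult_right_zero)
        finally show ?thesis using lizorkin_sheared_moments[OF \<psi> a] by simp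
      qed (simp add: rapid_zero[OF W])
    qed
    finally show ?thesis by simp
  qed
  then show ?thesis unfolding lizorkin_iff_moments using superposition_schwartz[OF W sch] by blast
qed

subsection \<open>Synthesis as a superposition\<close>

definition synthesis_weight ::
  "((real ^ 2) \<times> real \<times> real \<Rightarrow> complex) \<Rightarrow> (real ^ 2) \<times> real \<times> real \<Rightarrow> complex" where
  "synthesis_weight F p = of_real (\<bar>snd (snd p)\<bar> powr (- 3 / 4) / \<bar>snd (snd p)\<bar> ^ 3) * F p"

text \<open>One power of the weight covers \<open>|a| powr (- 3 / 4)\<close>, for small and large
  \<open>|a|\<close> alike, and three cover the measure factor.\<close>

lemma synthesis_factor_le:
  assumes "p \<in> shearlet_group"
  shows "\<bar>\<bar>snd (snd p)\<bar> powr (- 3 / 4) / \<bar>snd (snd p)\<bar> ^ 3\<bar> \<le> 1 * shearlet_weight p ^ 4"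
proof -
  obtain b s a where p: "p = (b, s, a)" and a: "a \<noteq> 0" using assms by (auto simp: shearlet_group_def)
  define r where "r = \<bar>a\<bar>"
  have r: "r > 0" using a by (simp add: r_def)
  have q: "r + 1 / r \<le> shearlet_weight p" using shearlet_weight_ge(5)[OF a, of b s] by (simp add: p r_def)
  have "r powr (- 3 / 4) \<le> r + 1 / r"
  proof (cases "r \<ge> 1")
    case True
    then have "r powr (- 3 / 4) \<le> r powr 0" by (intro powr_mono) auto
    then show ?thesis using True r sqrt_le_add_inverse(3)[OF r] by simp
  next
    case False
    then have "r powr (- 3 / 4) \<le> r powr (- 1)" using r by (intro powr_mono') auto
    then show ?thesis using r by (simp add: powr_minus_divide)
  qed
  then have 1: "r powr (- 3 / 4) \<le> shearlet_weight p" using q by linarith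
  have "1 / r \<le> shearlet_weight p" using q r by linarith
  then have "(1 / r) ^ 3 \<le> shearlet_weight p ^ 3" using r by (intro power_mono) auto
  then have "r powr (- 3 / 4) * (1 / r) ^ 3 \<le> shearlet_weight p * shearlet_weight p ^ 3"
    using 1 r by (intro mult_mono) (auto simp: shearlet_weight_nonneg)
  then show ?thesis using r by (simp add: p r_def power_divide eval_nat_numeral)
qed

lemma synthesis_weight_rapid: "F \<in> rapid \<Longrightarrow> synthesis_weight F \<in> rapid"
  unfolding synthesis_weight_def[abs_def]
  by (rule rapid_mult[where k = 1 and n = 4, OF _ _ _ synthesis_factor_le])
    (auto simp flip: borel_prod)

lemma decay_bound_synthesis_weight:
  "F \<in> rapid \<Longrightarrow> decay_bound (N + 4) F A \<Longrightarrow> decay_bound N (synthesis_weight F) A"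
  using decay_bound_mult[where k = 1 and n = 4, OF _ _ _ synthesis_factor_le, of F N A]
  unfolding synthesis_weight_def[abs_def] by simp

lemma synthesis_integrand_eq:
  assumes "F \<in> rapid"
  shows "synthesis_integrand \<psi> F x p = synthesis_weight F p * \<psi> (shearlet_arg x p)"
proof (cases "p \<in> shearlet_group")
  case True
  then obtain b s a where "p = (b, s, a)" "a \<noteq> 0" by (auto simp: shearlet_group_def)
  then show ?thesis
    by (simp add: synthesis_integrand_def synthesis_weight_def shearlet_arg_def shearlet_rep_eq)
qed (auto simp: synthesis_integrand_def synthesis_weight_def rapid_zero[OF assms] split: prod.split)

lemma synthesis_integrand_integrable:
  assumes "F \<in> rapid" "\<psi> \<in> schwartz_space"
  shows "integrable lborel (synthesis_integrand \<psi> F x)"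
  unfolding synthesis_integrand_eq[OF assms(1), abs_def]
  by (intro superposition_integrable_schwartz synthesis_weight_rapid assms)

text \<open>Absolute integrability on the product allows Fubini twice, splitting off
  \<open>b\<close> and afterwards \<open>s\<close>, in the prescribed order. Excluding
  \<open>a = 0\<close> from the outer integral changes nothing, since \<open>F\<close> is extended
  by 0 there.\<close>

lemma shearlet_synthesis_eq_superposition:
  assumes F: "F \<in> rapid" and \<psi>: "\<psi> \<in> schwartz_space"
  shows "shearlet_synthesis \<psi> F = superposition (synthesis_weight F) \<psi>"
proof
  fix x
  let ?f = "synthesis_integrand \<psi> F x"
  have int: "integrable (lborel \<Otimes>\<^sub>M lborel) (\<lambda>(b, q). ?f (b, q))"
    using synthesis_integrand_integrable[OF F \<psi>, of x] unfolding lborel_prod by simp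
  have int2: "integrable (lborel \<Otimes>\<^sub>M lborel) (\<lambda>(s, a). LINT b|lborel. ?f (b, s, a))"
    using lborel_pair.integrable_snd[OF int] unfolding lborel_prod by (simp add: case_prod_beta')
  have zero: "?f (b, s, 0) = 0" for b s
    unfolding synthesis_integrand_def using rapid_zero[OF F, of "(b, s, 0)"] by (simp add: shearlet_group_def)
  have "superposition (synthesis_weight F) \<psi> x = (LINT p|lborel. ?f p)"
    unfolding superposition_def synthesis_integrand_eq[OF F] ..
  also have "\<dots> = integral\<^sup>L (lborel \<Otimes>\<^sub>M lborel) (\<lambda>(b, q). ?f (b, q))"
    by (simp add: lborel_prod)
  also have "\<dots> = (LINT q|lborel. LINT b|lborel. ?f (b, q))"
    by (rule lborel_pair.integral_snd[OF int, symmetric])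
  also have "\<dots> = integral\<^sup>L (lborel \<Otimes>\<^sub>M lborel) (\<lambda>(s, a). LINT b|lborel. ?f (b, s, a))"
    by (simp add: lborel_prod case_prod_beta')
  also have "\<dots> = (LINT a|lborel. LINT s|lborel. LINT b|lborel. ?f (b, s, a))"
    by (rule lborel_pair.integral_snd[OF int2, symmetric])
  also have "\<dots> = shearlet_synthesis \<psi> F x"
    unfolding shearlet_synthesis_def set_lebesgue_integral_def
    by (intro Bochner_Integration.integral_cong refl) (simp add: zero split: split_indicator)
  finally show "shearlet_synthesis \<psi> F x = superposition (synthesis_weight F) \<psi> x" ..
qed

section \<open>Linear combinations and bilinearity\<close>

lemma rapid_lincomb:
  assumes F: "F \<in> rapid" and G: "G \<in> rapid"
  shows "(\<lambda>p. c * F p + d * G p) \<in> rapid"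
proof -
  note [measurable] = rapid_measurable[OF F] rapid_measurable[OF G]
  have "\<exists>A. decay_bound N (\<lambda>p. c * F p + d * G p) A" for N
  proof -
    obtain A B where A: "decay_bound N F A" and B: "decay_bound N G B"
      using rapid_decay F G by blast
    have "decay_bound N (\<lambda>p. c * F p + d * G p) (norm c * A + norm d * B)"
      unfolding decay_bound_def
    proof
      fix p
      have "shearlet_weight p ^ N * norm (c * F p + d * G p)
          \<le> shearlet_weight p ^ N * (norm c * norm (F p) + norm d * norm (G p))"
        using norm_triangle_ineq[of "c * F p" "d * G p"] shearlet_weight_nonneg[of p]
        by (intro mult_left_mono) (auto simp: norm_mult)
      also have "\<dots> = norm c * (shearlet_weight p ^ N * norm (F p)) + norm d * (shearlet_weight p ^ N * norm (G p))"
        by (simp add: algebra_simps)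
      also have "\<dots> \<le> norm c * A + norm d * B"
        using A B unfolding decay_bound_def by (intro add_mono mult_left_mono) (blast intro: norm_ge_zero)+
      finally show "shearlet_weight p ^ N * norm (c * F p + d * G p) \<le> norm c * A + norm d * B" .
    qed
    then show ?thesis by blast
  qed
  moreover have "(\<lambda>p. c * F p + d * G p) \<in> borel_measurable borel" by measurable
  ultimately show ?thesis using rapid_zero[OF F] rapid_zero[OF G] unfolding rapid_def by simp
qed

lemma schwartz_norm_lincomb_le:
  assumes "smooth_on UNIV f" "smooth_on UNIV g"
  shows "schwartz_norm \<nu> (\<lambda>x. c * f x + d * g x)
    \<le> ennreal (norm c) * schwartz_norm \<nu> f + ennreal (norm d) * schwartz_norm \<nu> g"
  unfolding schwartz_norm_def[of \<nu> "\<lambda>x. c * f x + d * g x"]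
proof (rule SUP_least, clarify)
  fix x :: "real ^ 2" and m :: "nat ^ 2" assume m: "(\<Sum>i\<in>UNIV. m $ i) \<le> \<nu>"
  have up: "ennreal (jbracket x ^ \<nu> * norm (partial_deriv m h x)) \<le> schwartz_norm \<nu> h" for h
    unfolding schwartz_norm_def by (rule SUP_upper2[of "(x, m)"]) (use m in auto)
  have "jbracket x ^ \<nu> * norm (c * partial_deriv m f x + d * partial_deriv m g x)
      \<le> jbracket x ^ \<nu> * (norm c * norm (partial_deriv m f x) + norm d * norm (partial_deriv m g x))"
    using norm_triangle_ineq[of "c * partial_deriv m f x" "d * partial_deriv m g x"] jbracket_pos[of x]
    by (intro mult_left_mono) (auto simp: norm_mult)
  also have "\<dots> = norm c * (jbracket x ^ \<nu> * norm (partial_deriv m f x))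
      + norm d * (jbracket x ^ \<nu> * norm (partial_deriv m g x))"
    by (simp add: algebra_simps)
  finally have "ennreal (jbracket x ^ \<nu> * norm (c * partial_deriv m f x + d * partial_deriv m g x))
      \<le> ennreal (norm c * (jbracket x ^ \<nu> * norm (partial_deriv m f x))
      + norm d * (jbracket x ^ \<nu> * norm (partial_deriv m g x)))"
    by (rule ennreal_leI)
  also have "\<dots> = ennreal (norm c) * ennreal (jbracket x ^ \<nu> * norm (partial_deriv m f x))
      + ennreal (norm d) * ennreal (jbracket x ^ \<nu> * norm (partial_deriv m g x))"
    using jbracket_pos[of x] by (simp add: ennreal_mult ennreal_plus)
  also have "\<dots> \<le> ennreal (norm c) * schwartz_norm \<nu> f + ennreal (norm d) * schwartz_norm \<nu> g"
    by (intro add_mono mult_left_mono up) auto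
  finally show "ennreal (jbracket x ^ \<nu> * norm (partial_deriv m (\<lambda>x. c * f x + d * g x) x))
      \<le> ennreal (norm c) * schwartz_norm \<nu> f + ennreal (norm d) * schwartz_norm \<nu> g"
    unfolding partial_deriv_lincomb[OF assms] .
qed

lemma schwartz_lincomb:
  assumes "f \<in> schwartz_space" "g \<in> schwartz_space"
  shows "(\<lambda>x. c * f x + d * g x) \<in> schwartz_space"
proof -
  have "schwartz_norm \<nu> (\<lambda>x. c * f x + d * g x) < \<infinity>" for \<nu>
    using schwartz_norm_lincomb_le[OF schwartz_smooth[OF assms(1)] schwartz_smooth[OF assms(2)], of \<nu> c d]
    by (rule le_less_trans)
      (use schwartz_norm_finite[OF assms(1)] schwartz_norm_finite[OF assms(2)] in
        \<open>auto simp: ennreal_mult_less_top\<close>)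
  then show ?thesis using assms smooth_lincomb[of f g c d] by (simp add: schwartz_space_def)
qed

lemma shearlet_synthesis_lincomb_left:
  assumes "F \<in> rapid" "G \<in> rapid" "\<psi> \<in> schwartz_space"
  shows "shearlet_synthesis \<psi> (\<lambda>p. c * F p + d * G p) =
    (\<lambda>x. c * shearlet_synthesis \<psi> F x + d * shearlet_synthesis \<psi> G x)"
proof
  fix x
  note int = superposition_integrable_schwartz[OF synthesis_weight_rapid assms(3)]
  have "synthesis_weight (\<lambda>p. c * F p + d * G p) p * \<psi> (shearlet_arg x p) =
      c * (synthesis_weight F p * \<psi> (shearlet_arg x p)) + d * (synthesis_weight G p * \<psi> (shearlet_arg x p))" for p
    by (simp add: synthesis_weight_def algebra_simps add_divide_distrib)
  then show "shearlet_synthesis \<psi> (\<lambda>p. c * F p + d * G p) x =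
      c * shearlet_synthesis \<psi> F x + d * shearlet_synthesis \<psi> G x"
    by (simp add: shearlet_synthesis_eq_superposition rapid_lincomb assms superposition_def int)
qed

lemma shearlet_synthesis_lincomb_right:
  assumes "F \<in> rapid" "\<phi> \<in> schwartz_space" "\<psi> \<in> schwartz_space"
  shows "shearlet_synthesis (\<lambda>x. c * \<phi> x + d * \<psi> x) F =
    (\<lambda>x. c * shearlet_synthesis \<phi> F x + d * shearlet_synthesis \<psi> F x)"
proof
  fix x
  note int = superposition_integrable_schwartz[OF synthesis_weight_rapid[OF assms(1)]]
  have "synthesis_weight F p * (c * \<phi> (shearlet_arg x p) + d * \<psi> (shearlet_arg x p)) =
      c * (synthesis_weight F p * \<phi> (shearlet_arg x p)) + d * (synthesis_weight F p * \<psi> (shearlet_arg x p))" for p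
    by (simp add: algebra_simps)
  then show "shearlet_synthesis (\<lambda>x. c * \<phi> x + d * \<psi> x) F x =
      c * shearlet_synthesis \<phi> F x + d * shearlet_synthesis \<psi> F x"
    by (simp add: shearlet_synthesis_eq_superposition schwartz_lincomb assms superposition_def int)
qed

lemma shearlet_synthesis_lizorkin:
  assumes "F \<in> rapid" "\<psi> \<in> lizorkin_space"
  shows "shearlet_synthesis \<psi> F \<in> lizorkin_space"
  by (simp add: shearlet_synthesis_eq_superposition superposition_lizorkin synthesis_weight_rapid
      lizorkin_schwartz assms)

subsection \<open>Test functions on the shearlet group\<close>

abbreviation shearlet_sup_norm :: "nat \<Rightarrow> ((real ^ 2) \<times> real \<times> real \<Rightarrow> complex) \<Rightarrow> ennreal" where
  "shearlet_sup_norm N \<equiv> shearlet_norm N N N N 0 0 0 0"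

text \<open>The factor \<open>2 ^ N\<close> comes from comparing \<open>(r + 1 / r) ^ N\<close> with
  \<open>r ^ N + 1 / r ^ N\<close> through the larger of \<open>r\<close> and \<open>1 / r\<close>.
  The bracket of \<open>b\<close> is at most the product of the brackets of its components.\<close>

lemma decay_bound_shearlet_sup_norm:
  assumes zero: "\<And>p. p \<notin> shearlet_group \<Longrightarrow> F p = 0"
    and A: "shearlet_sup_norm N F \<le> ennreal A" "0 \<le> A"
  shows "decay_bound N F (2 ^ N * A)"
  unfolding decay_bound_def
proof
  fix p
  show "shearlet_weight p ^ N * norm (F p) \<le> 2 ^ N * A"
  proof (cases "p \<in> shearlet_group")
    case True
    then obtain b s a where p: "p = (b, s, a)" and a: "a \<noteq> 0" by (auto simp: shearlet_group_def)
    define r where "r = \<bar>a\<bar>"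
    have r: "r > 0" using a by (simp add: r_def)
    let ?j = "jbracket (b $ 1) ^ N * jbracket (b $ 2) ^ N * jbracket s ^ N"
    have j: "0 \<le> ?j" 
      using jbracket_pos[of s] jbracket_pos[of "b $ 1"] jbracket_pos[of "b $ 2"] by simp
    have "ennreal (?j * (\<bar>a\<bar> ^ N + 1 / \<bar>a\<bar> ^ N) * norm (F (b, s, a))) \<le> shearlet_sup_norm N F"
      unfolding shearlet_norm_def
      by (rule SUP_upper2[of "(b, s, a)"]) (use a in \<open>auto simp: shearlet_group_def shearlet_deriv_def\<close>)
    also have "\<dots> \<le> ennreal A" by (rule A(1))
    finally have 1: "?j * (r ^ N + 1 / r ^ N) * norm (F p) \<le> A"
      using A(2) by (simp add: r_def p)
    have "(norm b)\<^sup>2 = (b $ 1)\<^sup>2 + (b $ 2)\<^sup>2"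
      by (simp add: norm_vec_def L2_set_def sum_2)
    then have jb: "jbracket b \<le> jbracket (b $ 1) * jbracket (b $ 2)"
      unfolding jbracket_def real_sqrt_mult[symmetric]
      by (intro real_sqrt_le_mono) (simp add: algebra_simps)
    have "r + 1 / r \<le> 2 * max r (1 / r)" by simp
    then have "(r + 1 / r) ^ N \<le> (2 * max r (1 / r)) ^ N" using r by (intro power_mono) auto
    also have "\<dots> = 2 ^ N * max r (1 / r) ^ N" by (rule power_mult_distrib)
    also have "\<dots> \<le> 2 ^ N * (r ^ N + 1 / r ^ N)"
      using r by (intro mult_left_mono) (auto simp: max_def power_divide)
    finally have 2: "(r + 1 / r) ^ N \<le> 2 ^ N * (r ^ N + 1 / r ^ N)" .
    have "shearlet_weight p ^ N = jbracket b ^ N * jbracket s ^ N * (r + 1 / r) ^ N"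
      by (simp add: shearlet_weight_def p r_def power_mult_distrib)
    also have "\<dots> \<le> (jbracket (b $ 1) * jbracket (b $ 2)) ^ N * jbracket s ^ N * (2 ^ N * (r ^ N + 1 / r ^ N))"
      using jb 2 r jbracket_pos[of b] jbracket_pos[of s] jbracket_pos[of "b $ 1"] jbracket_pos[of "b $ 2"]
      by (intro mult_mono power_mono) (auto intro: mult_nonneg_nonneg)
    also have "\<dots> = 2 ^ N * (?j * (r ^ N + 1 / r ^ N))" by (simp add: power_mult_distrib mult_ac)
    finally have "shearlet_weight p ^ N * norm (F p) \<le> 2 ^ N * (?j * (r ^ N + 1 / r ^ N)) * norm (F p)"
      by (rule mult_right_mono) simp
    also have "\<dots> = 2 ^ N * (?j * (r ^ N + 1 / r ^ N) * norm (F p))" by (simp only: mult.assoc)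
    also have "\<dots> \<le> 2 ^ N * A" using 1 by (intro mult_left_mono) auto
    finally show ?thesis .
  qed (use zero A in simp)
qed

lemma open_shearlet_group: "open shearlet_group"
proof -
  have "shearlet_group = UNIV \<times> UNIV \<times> (- {0})" by (auto simp: shearlet_group_def)
  also have "open \<dots>" by (intro open_Times) auto
  finally show ?thesis .
qed

lemma shearlet_space_rapid:
  assumes F: "F \<in> shearlet_space"
  shows "F \<in> rapid"
proof -
  have zero: "F p = 0" if "p \<notin> shearlet_group" for p
    using F that unfolding shearlet_space_def by blast
  have "Ck_on 0 shearlet_group F" using F unfolding shearlet_space_def smooth_on_def by blast
  then have "continuous_on shearlet_group F" by simp
  \<comment> \<open>Continuity is known only on the open group; extension by 0 turns it into
    measurability on the whole space.\<close>
  then have "(\<lambda>p. indicator shearlet_group p *\<^sub>R F p) \<in> borel_measurable borel"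
    by (intro borel_measurable_continuous_on_indicator) (simp_all add: open_shearlet_group)
  moreover have "(\<lambda>p. indicator shearlet_group p *\<^sub>R F p) = F"
    by (auto simp: zero split: split_indicator)
  ultimately have m: "F \<in> borel_measurable borel" by simp
  have "\<exists>A. decay_bound N F A" for N
  proof -
    have "shearlet_sup_norm N F < \<infinity>" using F unfolding shearlet_space_def by blast
    then obtain A where "0 \<le> A" "shearlet_sup_norm N F = ennreal A"
      by (cases "shearlet_sup_norm N F") auto
    then show ?thesis using decay_bound_shearlet_sup_norm[of F N A] zero by auto
  qed
  then show ?thesis unfolding rapid_def using m zero by blast
qed

text \<open>The bilinear estimate behind continuity; the order \<open>3 * \<nu> + 10\<close> is that
  of the superposition bound plus 4 for the powers of \<open>|a|\<close>. Real bounds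
  \<open>A\<close> and \<open>B\<close> in place of the norms keep the arithmetic in the reals, and
  with \<open>F \<in> rapid\<close> it applies directly to differences of test functions.\<close>

lemma schwartz_norm_shearlet_synthesis_le:
  fixes \<nu> :: nat
  obtains C where "0 \<le> C" "\<And>F \<psi> A B. F \<in> rapid \<Longrightarrow> \<psi> \<in> schwartz_space \<Longrightarrow>
    shearlet_sup_norm (3 * \<nu> + 10) F \<le> ennreal A \<Longrightarrow> 0 \<le> A \<Longrightarrow>
    schwartz_norm (2 * \<nu>) \<psi> \<le> ennreal B \<Longrightarrow> 0 \<le> B \<Longrightarrow>
    schwartz_norm \<nu> (shearlet_synthesis \<psi> F) \<le> ennreal (C * A * B)"
proof
  let ?C = "64 ^ \<nu> * jbracket_integral * 2 ^ (3 * \<nu> + 10)"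
  show "0 \<le> ?C" using jbracket_integral_nonneg by simp
  fix F \<psi> A B
  assume F: "F \<in> rapid" and \<psi>: "\<psi> \<in> schwartz_space"
    and A: "shearlet_sup_norm (3 * \<nu> + 10) F \<le> ennreal A" "0 \<le> A"
    and B: "schwartz_norm (2 * \<nu>) \<psi> \<le> ennreal B" "0 \<le> B"
  have "decay_bound (3 * \<nu> + 10) F (2 ^ (3 * \<nu> + 10) * A)"
    by (rule decay_bound_shearlet_sup_norm[OF rapid_zero[OF F] A])
  then have "decay_bound (3 * \<nu> + 6) (synthesis_weight F) (2 ^ (3 * \<nu> + 10) * A)"
    by (intro decay_bound_synthesis_weight F) (simp only: add.assoc, simp)
  from schwartz_norm_superposition_le[OF synthesis_weight_rapid[OF F] \<psi> this B]
  show "schwartz_norm \<nu> (shearlet_synthesis \<psi> F) \<le> ennreal (?C * A * B)"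
    by (simp add: shearlet_synthesis_eq_superposition[OF F \<psi>] mult.assoc)
qed

text \<open>It is enough to test preimages of subbasic semi-balls. Near a given pair the change of
  the image splits, by bilinearity, into \<open>T(F - F0, \<psi>) + T(F0, \<psi> - \<psi>0)\<close>,
  and the bilinear estimate applies to both terms.\<close>

lemma continuous_map_shearlet_synthesis:
  "continuous_map (prod_topology shearlet_topology lizorkin_topology) lizorkin_topology
     (\<lambda>(F, \<psi>). shearlet_synthesis \<psi> F)"
    (is "continuous_map ?X _ ?T")
proof -
  have top: "topspace ?X = shearlet_space \<times> lizorkin_space"
    by (simp add: topspace_shearlet_topology topspace_lizorkin_topology)
  have img: "?T z \<in> lizorkin_space" if "z \<in> topspace ?X" for z
    using that unfolding top by (auto intro: shearlet_synthesis_lizorkin shearlet_space_rapid)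
  have "continuous_map ?X schwartz_topology ?T"
    unfolding schwartz_topology_def seminorm_topology_def
  proof (rule continuous_on_generated_topo)
    show "?T ` topspace ?X \<subseteq> \<Union> {{g \<in> schwartz_space. p (\<lambda>x. g x - f x) < ennreal e} |p f e.
        p \<in> range schwartz_norm \<and> f \<in> schwartz_space \<and> 0 < e}"
      unfolding topology_generated_by_topspace[symmetric] seminorm_topology_def[symmetric]
        schwartz_topology_def[symmetric] topspace_schwartz_topology
      using img lizorkin_schwartz by (intro image_subsetI) blast
  next
    fix U
    assume "U \<in> {{g \<in> schwartz_space. p (\<lambda>x. g x - f x) < ennreal e} |p f e.
        p \<in> range schwartz_norm \<and> f \<in> schwartz_space \<and> 0 < e}"
    then obtain \<nu> g e where g: "g \<in> schwartz_space" and e: "0 < e"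
      and U: "U = {h \<in> schwartz_space. schwartz_norm \<nu> (\<lambda>x. h x - g x) < ennreal e}" by blast
    obtain C where C: "0 \<le> C" "\<And>F \<psi> A B. F \<in> rapid \<Longrightarrow> \<psi> \<in> schwartz_space \<Longrightarrow>
        shearlet_sup_norm (3 * \<nu> + 10) F \<le> ennreal A \<Longrightarrow> 0 \<le> A \<Longrightarrow>
        schwartz_norm (2 * \<nu>) \<psi> \<le> ennreal B \<Longrightarrow> 0 \<le> B \<Longrightarrow>
        schwartz_norm \<nu> (shearlet_synthesis \<psi> F) \<le> ennreal (C * A * B)"
      using schwartz_norm_shearlet_synthesis_le[of \<nu>] by blast
    show "openin ?X (?T -` U \<inter> topspace ?X)"
    proof (subst openin_subopen, safe)
      fix F0 \<psi>0 assume z: "(F0, \<psi>0) \<in> topspace ?X" and inU: "shearlet_synthesis \<psi>0 F0 \<in> U"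
      have F0: "F0 \<in> shearlet_space" and \<psi>0: "\<psi>0 \<in> lizorkin_space" using z unfolding top by auto
      note rF0 = shearlet_space_rapid[OF F0] and s\<psi>0 = lizorkin_schwartz[OF \<psi>0]
      \<comment> \<open>The semi-ball is centred at an arbitrary \<open>g\<close>, not at the image
        of the given pair, so only the gap \<open>e - r\<close> is available for the
        perturbation.\<close>
      let ?f0 = "\<lambda>x. shearlet_synthesis \<psi>0 F0 x - g x"
      have s0: "smooth_on UNIV (shearlet_synthesis \<psi>0 F0)"
        by (intro schwartz_smooth lizorkin_schwartz shearlet_synthesis_lizorkin rF0 \<psi>0)
      have sf0: "smooth_on UNIV ?f0"
        using smooth_lincomb[OF s0 schwartz_smooth[OF g], of 1 "-1"] by simp
      have lt: "schwartz_norm \<nu> ?f0 < ennreal e" using inU unfolding U by blast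
      then have "schwartz_norm \<nu> ?f0 < \<infinity>" by (rule less_trans) simp
      then obtain r where r: "0 \<le> r" "schwartz_norm \<nu> ?f0 = ennreal r" by (rule schwartz_norm_boundE)
      have re: "r < e" using lt r e by (simp add: ennreal_less_iff)
      obtain P0 where P0: "0 \<le> P0" "schwartz_norm (2 * \<nu>) \<psi>0 = ennreal P0"
        using schwartz_norm_boundE schwartz_norm_finite[OF s\<psi>0] by metis
      have "shearlet_sup_norm (3 * \<nu> + 10) F0 < \<infinity>" using F0 unfolding shearlet_space_def by blast
      then obtain N0 where N0: "0 \<le> N0" "shearlet_sup_norm (3 * \<nu> + 10) F0 = ennreal N0"
        by (cases "shearlet_sup_norm (3 * \<nu> + 10) F0") auto
      \<comment> \<open>\<open>P0 + 1\<close> bounds the norm of \<psi> because \<delta> is at most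
        1, and \<open>N0\<close> is the norm of \<open>F0\<close>. The last summand makes
        \<open>K\<close> positive, so that one may divide by it even if
        \<open>C = 0\<close>.\<close>
      define K where "K = C * (P0 + 1 + N0) + 1"
      have K: "0 < K" using C(1) P0 N0 by (simp add: K_def add_nonneg_pos)
      define \<delta> where "\<delta> = min 1 ((e - r) / (2 * K))"
      have \<delta>: "0 < \<delta>" "\<delta> \<le> 1" using re K by (auto simp: \<delta>_def)
      have "\<delta> * K \<le> (e - r) / (2 * K) * K" using K by (intro mult_right_mono) (auto simp: \<delta>_def)
      also have "\<dots> < e - r" using K re by simp
      finally have \<delta>K: "\<delta> * K < e - r" .
      let ?V = "{F \<in> shearlet_space. shearlet_sup_norm (3 * \<nu> + 10) (\<lambda>p. F p - F0 p) < ennreal \<delta>}"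
      \<comment> \<open>A Schwartz semi-ball cut down to the Lizorkin space, as the relative
        topology prescribes.\<close>
      let ?W = "{\<psi> \<in> schwartz_space. schwartz_norm (2 * \<nu>) (\<lambda>x. \<psi> x - \<psi>0 x) < ennreal \<delta>} \<inter> lizorkin_space"
      have opV: "openin shearlet_topology ?V"
        unfolding shearlet_topology_def seminorm_topology_def
        by (rule topology_generated_by_Basis) (use F0 \<delta>(1) in blast)
      have opW: "openin lizorkin_topology ?W"
        unfolding lizorkin_topology_def schwartz_topology_def seminorm_topology_def
        by (intro openin_subtopology_Int topology_generated_by_Basis) (use s\<psi>0 \<delta>(1) in blast)
      have "(\<lambda>p. F0 p - F0 p) = (\<lambda>p. 0)" "(\<lambda>x. \<psi>0 x - \<psi>0 x) = (\<lambda>x. 0)" by auto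
      moreover have "shearlet_sup_norm (3 * \<nu> + 10) (\<lambda>p. 0) = 0"
        by (auto simp: shearlet_norm_def shearlet_deriv_def intro!: antisym SUP_least)
      moreover have "schwartz_norm (2 * \<nu>) (\<lambda>x. 0) = 0"
        by (auto simp: schwartz_norm_def partial_deriv_def funpow_dir_deriv_zero intro!: antisym SUP_least)
      ultimately have mem: "(F0, \<psi>0) \<in> ?V \<times> ?W" using F0 \<psi>0 s\<psi>0 \<delta>(1) by simp
      have sub: "?V \<times> ?W \<subseteq> ?T -` U \<inter> topspace ?X"
      proof clarify
        fix F \<psi>
        assume F: "F \<in> shearlet_space" and dF: "shearlet_sup_norm (3 * \<nu> + 10) (\<lambda>p. F p - F0 p) < ennreal \<delta>"
          and s\<psi>: "\<psi> \<in> schwartz_space" and d\<psi>: "schwartz_norm (2 * \<nu>) (\<lambda>x. \<psi> x - \<psi>0 x) < ennreal \<delta>"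
          and \<psi>: "\<psi> \<in> lizorkin_space"
        note rF = shearlet_space_rapid[OF F]
        let ?F = "\<lambda>p. F p - F0 p" and ?\<psi> = "\<lambda>x. \<psi> x - \<psi>0 x"
        have rd: "?F \<in> rapid" using rapid_lincomb[OF rF rF0, of 1 "-1"] by simp
        have sd: "?\<psi> \<in> schwartz_space" using schwartz_lincomb[OF s\<psi> s\<psi>0, of 1 "-1"] by simp
        let ?A = "shearlet_synthesis \<psi> ?F" and ?B = "shearlet_synthesis ?\<psi> F0"
        have sA: "smooth_on UNIV ?A"
          by (simp add: shearlet_synthesis_eq_superposition rd s\<psi> superposition_smooth synthesis_weight_rapid)
        have sB: "smooth_on UNIV ?B"
          by (simp add: shearlet_synthesis_eq_superposition rF0 sd superposition_smooth synthesis_weight_rapid)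
        have A: "?A x = shearlet_synthesis \<psi> F x - shearlet_synthesis \<psi> F0 x" for x
          using fun_cong[OF shearlet_synthesis_lincomb_left[OF rF rF0 s\<psi>, of 1 "-1"], of x] by simp
        have B: "?B x = shearlet_synthesis \<psi> F0 x - shearlet_synthesis \<psi>0 F0 x" for x
          using fun_cong[OF shearlet_synthesis_lincomb_right[OF rF0 s\<psi> s\<psi>0, of 1 "-1"], of x] by simp
        have "schwartz_norm (2 * \<nu>) (\<lambda>x. 1 * ?\<psi> x + 1 * \<psi>0 x) \<le> ennreal (norm (1::complex)) * schwartz_norm (2 * \<nu>) ?\<psi>
            + ennreal (norm (1::complex)) * schwartz_norm (2 * \<nu>) \<psi>0"
          by (intro schwartz_norm_lincomb_le schwartz_smooth sd s\<psi>0)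
        then have "schwartz_norm (2 * \<nu>) \<psi> \<le> schwartz_norm (2 * \<nu>) ?\<psi> + ennreal P0"
          using P0 by simp
        also have "\<dots> \<le> ennreal 1 + ennreal P0"
          using d\<psi> \<delta>(2) by (intro add_mono order_refl) (meson ennreal_leI less_imp_le order_trans)
        also have "\<dots> = ennreal (1 + P0)" using P0 by (simp add: ennreal_plus)
        finally have n\<psi>: "schwartz_norm (2 * \<nu>) \<psi> \<le> ennreal (1 + P0)" .
        have nA: "schwartz_norm \<nu> ?A \<le> ennreal (C * \<delta> * (1 + P0))"
          by (rule C(2)[OF rd s\<psi> _ _ n\<psi>]) (use dF \<delta> P0 in auto)
        have nB: "schwartz_norm \<nu> ?B \<le> ennreal (C * N0 * \<delta>)"
          by (rule C(2)[OF rF0 sd _ N0(1)]) (use d\<psi> \<delta> N0 in auto)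
        have sAB: "smooth_on UNIV (\<lambda>x. 1 * ?A x + 1 * ?B x)" by (intro smooth_lincomb sA sB)
        have "(\<lambda>x. shearlet_synthesis \<psi> F x - g x) = (\<lambda>x. 1 * ?f0 x + 1 * (1 * ?A x + 1 * ?B x))"
          unfolding A B by simp
        then have "schwartz_norm \<nu> (\<lambda>x. shearlet_synthesis \<psi> F x - g x)
            \<le> schwartz_norm \<nu> ?f0 + schwartz_norm \<nu> (\<lambda>x. 1 * ?A x + 1 * ?B x)"
          using schwartz_norm_lincomb_le[OF sf0 sAB, of \<nu> 1 1] by simp
        also have "\<dots> \<le> schwartz_norm \<nu> ?f0 + (schwartz_norm \<nu> ?A + schwartz_norm \<nu> ?B)"
          using schwartz_norm_lincomb_le[OF sA sB, of \<nu> 1 1] by (intro add_mono order_refl) simp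
        also have "\<dots> \<le> ennreal r + (ennreal (C * \<delta> * (1 + P0)) + ennreal (C * N0 * \<delta>))"
          unfolding r(2) by (intro add_mono order_refl nA nB)
        also have "\<dots> = ennreal (r + (C * \<delta> * (1 + P0) + C * N0 * \<delta>))"
          using r C(1) \<delta> P0 N0 by (simp add: ennreal_plus)
        also have "\<dots> < ennreal e"
        proof (rule ennreal_lessI[OF e])
          have "C * \<delta> * (1 + P0) + C * N0 * \<delta> = \<delta> * K - \<delta>" by (simp add: K_def algebra_simps)
          then show "r + (C * \<delta> * (1 + P0) + C * N0 * \<delta>) < e" using \<delta>K \<delta>(1) by linarith
        qed
        finally have "schwartz_norm \<nu> (\<lambda>x. shearlet_synthesis \<psi> F x - g x) < ennreal e" .
        moreover have "(F, \<psi>) \<in> topspace ?X" unfolding top using F \<psi> by simp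
        moreover have "shearlet_synthesis \<psi> F \<in> schwartz_space"
          by (intro lizorkin_schwartz shearlet_synthesis_lizorkin rF \<psi>)
        ultimately show "(F, \<psi>) \<in> ?T -` U \<inter> topspace ?X" unfolding U by simp
      qed
      show "\<exists>S. openin ?X S \<and> (F0, \<psi>0) \<in> S \<and> S \<subseteq> ?T -` U \<inter> topspace ?X"
        using opV opW mem sub by (intro exI[of _ "?V \<times> ?W"]) (simp add: openin_prod_Times_iff)
    qed
  qed
  then show ?thesis
    unfolding lizorkin_topology_def continuous_map_in_subtopology
    using img unfolding lizorkin_topology_def by auto
qed

theorem theorem6:
  shows "(\<forall>F\<in>shearlet_space. \<forall>\<psi>\<in>lizorkin_space. \<forall>x.
            set_integrable lborel shearlet_group (synthesis_integrand \<psi> F x))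
       \<and> bilinear_on_spaces shearlet_space lizorkin_space (\<lambda>F \<psi>. shearlet_synthesis \<psi> F)
       \<and> continuous_map (prod_topology shearlet_topology lizorkin_topology) lizorkin_topology
            (\<lambda>(F, \<psi>). shearlet_synthesis \<psi> F)
       \<and> (\<forall>\<psi>\<in>lizorkin_space.
            linear_on_space shearlet_space (shearlet_synthesis \<psi>) \<and>
            continuous_map shearlet_topology lizorkin_topology (shearlet_synthesis \<psi>))"
proof (intro conjI ballI allI)
  fix F \<psi> x assume F: "F \<in> shearlet_space" and \<psi>: "\<psi> \<in> lizorkin_space"
  \<comment> \<open>Absolute convergence on the whole group is what gives the iterated integral its
    intended meaning, as integrals of non-integrable functions would default to 0.\<close>
  have "integrable lborel (synthesis_integrand \<psi> F x)"
    by (intro synthesis_integrand_integrable shearlet_space_rapid lizorkin_schwartz F \<psi>)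
  then show "set_integrable lborel shearlet_group (synthesis_integrand \<psi> F x)"
    unfolding set_integrable_def using open_shearlet_group
    by (intro integrable_mult_indicator) simp_all
next
  show "continuous_map (prod_topology shearlet_topology lizorkin_topology) lizorkin_topology
      (\<lambda>(F, \<psi>). shearlet_synthesis \<psi> F)"
    by (rule continuous_map_shearlet_synthesis)
  show lin: "linear_on_space shearlet_space (shearlet_synthesis \<psi>)" if "\<psi> \<in> lizorkin_space" for \<psi>
    unfolding linear_on_space_def using that
    by (auto intro!: shearlet_synthesis_lincomb_left shearlet_space_rapid lizorkin_schwartz)
  then show "bilinear_on_spaces shearlet_space lizorkin_space (\<lambda>F \<psi>. shearlet_synthesis \<psi> F)"
    unfolding bilinear_on_spaces_def
    by (auto simp: linear_on_space_def
      intro!: shearlet_synthesis_lincomb_right shearlet_space_rapid lizorkin_schwartz)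
next
  fix \<psi> assume \<psi>: "\<psi> \<in> lizorkin_space"
  have "continuous_map shearlet_topology (prod_topology shearlet_topology lizorkin_topology) (\<lambda>F. (F, \<psi>))"
    using \<psi> by (intro continuous_map_pairedI) (auto simp: topspace_lizorkin_topology)
  from continuous_map_compose[OF this continuous_map_shearlet_synthesis]
  show "continuous_map shearlet_topology lizorkin_topology (shearlet_synthesis \<psi>)"
    by (simp add: o_def)
qed

end
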